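(* Let $\lambda\ge1$ be an integer. Then for every odd prime $p$, $$\tau_{8,2}(p^\lambda)\equiv\sigma_7(p^\lambda)\pmod{17},$$ and for every prime $p\ge5$, $$\tau_{8,3}(p^\lambda)\equiv\sigma_7(p^\lambda)\pmod{41}.$$ In particular, for every integer $\lambda\ge1$, $\tau_{8,2}(17^\lambda)\equiv1\pmod{17}$ and $\tau_{8,3}(41^\lambda)\equiv1\pmod{41}$.
   Context: $\sigma_7(n)=\sum_{e\mid n}e^7$. With $\eta(z)=q^{1/24}\prod_{n\ge1}(1-q^n)$, $q=e^{2\pi iz}$: $\Delta_{8,2}(z)=\eta^8(z)\eta^8(2z)=\sum_{n\ge1}\tau_{8,2}(n)q^n$ is the normalized newform of weight 8 and level 2, and $\Delta_{8,3}(z)=\eta^{12}(z)\eta^4(3z)+18\eta^9(z)\eta^4(3z)\eta^3(9z)+81\eta^6(z)\eta^4(3z)\eta^6(9z)=\sum_{n\ge1}\tau_{8,3}(n)q^n$ is the normalized newform of weight 8 and level 3. *)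

theory Defs
  imports "HOL-Complex_Analysis.Complex_Analysis" "HOL-Number_Theory.Number_Theory"
begin

definition divisor_sum :: "nat \<Rightarrow> nat \<Rightarrow> nat" where
  "divisor_sum k n = (\<Sum>e | e dvd n. e ^ k)"

definition nome :: "complex \<Rightarrow> complex" where
  "nome z = exp (2 * of_real pi * \<i> * z)"

(* The factor q^(1/24) is exp (2 pi i z / 24), not the principal 24th root of q. *)
definition dedekind_eta :: "complex \<Rightarrow> complex" where
  "dedekind_eta z = exp (2 * of_real pi * \<i> * z / 24) * (\<Prod>n. 1 - nome z ^ Suc n)"

definition Delta_8_2 :: "complex \<Rightarrow> complex" where
  "Delta_8_2 z = dedekind_eta z ^ 8 * dedekind_eta (2 * z) ^ 8"

definition Delta_8_3 :: "complex \<Rightarrow> complex" where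
  "Delta_8_3 z =
     dedekind_eta z ^ 12 * dedekind_eta (3 * z) ^ 4
     + 18 * dedekind_eta z ^ 9 * dedekind_eta (3 * z) ^ 4 * dedekind_eta (9 * z) ^ 3
     + 81 * dedekind_eta z ^ 6 * dedekind_eta (3 * z) ^ 4 * dedekind_eta (9 * z) ^ 6"

definition has_q_expansion :: "(complex \<Rightarrow> complex) \<Rightarrow> (nat \<Rightarrow> int) \<Rightarrow> bool" where
  "has_q_expansion f a \<longleftrightarrow> (\<forall>z. Im z > 0 \<longrightarrow> (\<lambda>n. of_int (a n) * nome z ^ n) sums f z)"

(* The descriptions are proper: see has_q_expansion_tau_8_2 and has_q_expansion_tau_8_3
   for existence, has_q_expansion_unique for uniqueness. The summation here starts at 0;
   the constant terms vanish by tau_8_2_0 and tau_8_3_0. *)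
definition tau_8_2 :: "nat \<Rightarrow> int" where
  "tau_8_2 = (THE a. has_q_expansion Delta_8_2 a)"

definition tau_8_3 :: "nat \<Rightarrow> int" where
  "tau_8_3 = (THE a. has_q_expansion Delta_8_3 a)"


lemma norm_nome: "norm (nome z) = exp (- (2 * pi * Im z))"
  by (simp add: nome_def)

lemma norm_nome_less_1: "Im z > 0 \<Longrightarrow> norm (nome z) < 1"
  by (simp add: norm_nome)

lemma nome_surj:
  assumes "q \<noteq> 0" "norm q < 1"
  obtains z where "Im z > 0" "nome z = q"
proof
  let ?z = "Ln q / (2 * of_real pi * \<i>)"
  show q: "nome ?z = q"
    using assms by (simp add: nome_def)
  have "exp (- (2 * pi * Im ?z)) < exp 0"
    using assms norm_nome[of ?z] by (simp only: q exp_zero)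
  hence "2 * pi * Im ?z > 0"
    by (simp only: exp_less_cancel_iff)
  thus "Im ?z > 0"
    by (rule zero_less_mult_pos) simp
qed

lemma has_q_expansion_unique:
  assumes "has_q_expansion f a" "has_q_expansion f b"
  shows   "a = b"
proof -
  define d where "d = (\<lambda>n. of_int (a n - b n) :: complex)"
  have d: "(\<lambda>n. d n * q ^ n) sums 0" if q: "q \<noteq> 0" "norm q < 1" for q
  proof -
    obtain z where z: "Im z > 0" "nome z = q"
      using nome_surj[OF q] by metis
    from z assms have "(\<lambda>n. of_int (a n) * q ^ n - of_int (b n) * q ^ n) sums (f z - f z)"
      unfolding has_q_expansion_def by (intro sums_diff) auto
    thus ?thesis
      by (simp add: d_def algebra_simps)
  qed
  have "((\<lambda>_. 0) \<longlongrightarrow> d 0) (at (0::complex))"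
    using powser_limit_0_strong[of 1 d "\<lambda>_. 0"] d by auto
  hence d0: "d 0 = 0"
    using LIM_unique tendsto_const by blast
  have d': "(\<lambda>n. d n * (q - 0) ^ n) sums 0" if "norm (q - 0) < 1" for q
    using d[of q] powser_sums_zero[of d] d0 that by (cases "q = 0") auto
  have "d m = 0" for m
  proof (rule ccontr)
    assume m: "d m \<noteq> 0"
    hence "m > 0"
      using d0 by (intro Nat.gr0I) auto
    show False
    proof (rule powser_0_nonzero[where f = "\<lambda>_. 0", OF zero_less_one d' refl m \<open>m > 0\<close>])
      fix s :: real
      assume s: "0 < s" "\<And>z. z \<in> cball 0 s - {0 :: complex} \<Longrightarrow> (0 :: complex) \<noteq> 0"
      have "of_real s \<in> cball 0 s - {0 :: complex}"
        using s(1) by simp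
      thus False
        using s(2) by blast
    qed
  qed
  thus ?thesis
    by (auto simp: d_def fun_eq_iff)
qed

(* The series converges on the whole open unit disc because f is holomorphic there. *)
definition integral_power_series :: "(complex \<Rightarrow> complex) \<Rightarrow> bool" where
  "integral_power_series f \<longleftrightarrow>
     f holomorphic_on ball 0 1 \<and> (\<exists>F. f has_fps_expansion F \<and> (\<forall>n. fps_nth F n \<in> \<int>))"

lemma integral_power_series_mult:
  assumes "integral_power_series f" "integral_power_series g"
  shows   "integral_power_series (\<lambda>q. f q * g q)"
proof -
  obtain F G where "f has_fps_expansion F" "\<And>n. fps_nth F n \<in> \<int>"
                   "g has_fps_expansion G" "\<And>n. fps_nth G n \<in> \<int>"
    using assms by (auto simp: integral_power_series_def)
  hence "(\<lambda>q. f q * g q) has_fps_expansion F * G" "\<And>n. fps_nth (F * G) n \<in> \<int>"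
    by (auto intro!: has_fps_expansion_mult Ints_sum Ints_mult simp: fps_mult_nth)
  thus ?thesis
    using assms unfolding integral_power_series_def
    by (auto intro!: holomorphic_intros exI[of _ "F * G"])
qed

lemma integral_power_series_add:
  assumes "integral_power_series f" "integral_power_series g"
  shows   "integral_power_series (\<lambda>q. f q + g q)"
proof -
  obtain F G where "f has_fps_expansion F" "\<And>n. fps_nth F n \<in> \<int>"
                   "g has_fps_expansion G" "\<And>n. fps_nth G n \<in> \<int>"
    using assms by (auto simp: integral_power_series_def)
  hence "(\<lambda>q. f q + g q) has_fps_expansion F + G" "\<And>n. fps_nth (F + G) n \<in> \<int>"
    by (auto intro!: has_fps_expansion_add)
  thus ?thesis
    using assms unfolding integral_power_series_def
    by (auto intro!: holomorphic_intros exI[of _ "F + G"])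
qed

lemma integral_power_series_const: "c \<in> \<int> \<Longrightarrow> integral_power_series (\<lambda>_. c)"
  unfolding integral_power_series_def by (auto intro!: exI[of _ "fps_const c"])

lemma integral_power_series_ident: "integral_power_series (\<lambda>q. q)"
  unfolding integral_power_series_def by (auto intro!: exI[of _ fps_X] has_fps_expansion_fps_X)

lemma integral_power_series_power:
  "integral_power_series f \<Longrightarrow> integral_power_series (\<lambda>q. f q ^ n)"
  by (induction n) (auto intro!: integral_power_series_mult integral_power_series_const)

lemma integral_power_series_diff:
  assumes "integral_power_series f" "integral_power_series g"
  shows   "integral_power_series (\<lambda>q. f q - g q)"
  using integral_power_series_add[OF assms(1)
          integral_power_series_mult[OF integral_power_series_const[of "-1"] assms(2)]]
  by simp

lemma integral_power_series_prod:
  "finite A \<Longrightarrow> (\<And>i. i \<in> A \<Longrightarrow> integral_power_series (f i)) \<Longrightarrow>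
     integral_power_series (\<lambda>q. \<Prod>i\<in>A. f i q)"
  by (induction A rule: finite_induct)
     (auto intro!: integral_power_series_mult integral_power_series_const)

lemma integral_power_series_coeff:
  assumes "integral_power_series f"
  shows   "(deriv ^^ n) f 0 / fact n \<in> \<int>"
proof -
  obtain F where "f has_fps_expansion F" "\<And>n. fps_nth F n \<in> \<int>"
    using assms by (auto simp: integral_power_series_def)
  thus ?thesis
    using fps_nth_fps_expansion[of f F n] by metis
qed

lemma integral_power_series_sums:
  assumes "integral_power_series f"
  obtains a where "\<And>q. norm q < 1 \<Longrightarrow> (\<lambda>n. of_int (a n) * q ^ n) sums f q"
proof -
  define a where "a = (\<lambda>n. \<lfloor>Re ((deriv ^^ n) f 0 / fact n)\<rfloor>)"
  have a: "of_int (a n) = (deriv ^^ n) f 0 / fact n" for n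
    using integral_power_series_coeff[OF assms, of n] by (auto simp: a_def elim!: Ints_cases)
  have "(\<lambda>n. of_int (a n) * q ^ n) sums f q" if "norm q < 1" for q
    using holomorphic_power_series[of f 0 1 q] assms that
    by (simp add: a integral_power_series_def)
  thus ?thesis
    using that by blast
qed

(* Locally uniform limits preserve integrality of the Taylor coefficients. *)
lemma integral_power_series_uniform_limit:
  assumes P: "\<And>N. integral_power_series (P N)"
  assumes lim: "\<And>r. 0 < r \<Longrightarrow> r < 1 \<Longrightarrow> uniform_limit (cball 0 r) P f sequentially"
  shows   "integral_power_series f"
proof -
  have holP: "P N holomorphic_on ball 0 1" for N
    using P[of N] by (simp add: integral_power_series_def)
  have holf: "f holomorphic_on ball 0 1"
  proof (rule holomorphic_uniform_sequence[where f = P])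
    fix x :: complex assume x: "x \<in> ball 0 1"
    define d where "d = (1 - norm x) / 2"
    have d: "d > 0" "norm x + d < 1"
      using x by (auto simp: d_def field_simps)
    have "norm x + d > 0"
      using d norm_ge_zero[of x] by linarith
    have sub: "cball x d \<subseteq> cball 0 (norm x + d)"
    proof
      fix y assume "y \<in> cball x d"
      thus "y \<in> cball 0 (norm x + d)"
        using norm_triangle_ineq[of x "y - x"] by (simp add: dist_norm norm_minus_commute)
    qed
    have "cball x d \<subseteq> ball 0 1"
      using sub d by force
    moreover have "uniform_limit (cball x d) P f sequentially"
      by (rule uniform_limit_on_subset[OF lim sub]) fact+
    ultimately show "\<exists>d>0. cball x d \<subseteq> ball 0 1 \<and> uniform_limit (cball x d) P f sequentially"
      using d by blast
  qed (use holP in auto)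
  have coeff: "(deriv ^^ n) f 0 / fact n \<in> \<int>" for n
  proof -
    have "(\<lambda>N. (deriv ^^ n) (P N) 0 / fact n) \<longlonglongrightarrow> (deriv ^^ n) f 0 / fact n"
    proof (rule tendstoI)
      fix e :: real assume e: "e > 0"
      define B where "B = e / 2 * (1/2) ^ n"
      have B: "B > 0" using e by (simp add: B_def)
      have "\<forall>\<^sub>F N in sequentially. \<forall>x\<in>cball 0 (1/2). dist (P N x) (f x) < B"
        using lim[of "1/2"] B by (auto simp: uniform_limit_iff)
      thus "\<forall>\<^sub>F N in sequentially.
              dist ((deriv ^^ n) (P N) 0 / fact n) ((deriv ^^ n) f 0 / fact n) < e"
      proof eventually_elim
        case (elim N)
        have hol: "(\<lambda>x. P N x - f x) holomorphic_on ball 0 1"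
          by (intro holomorphic_intros holP holf)
        have "norm ((deriv ^^ n) (\<lambda>x. P N x - f x) 0) \<le> fact n * B / (1/2) ^ n"
        proof (rule Cauchy_inequality)
          show "(\<lambda>x. P N x - f x) holomorphic_on ball 0 (1/2)"
            by (rule holomorphic_on_subset[OF hol]) auto
          show "continuous_on (cball 0 (1/2)) (\<lambda>x. P N x - f x)"
            by (rule holomorphic_on_imp_continuous_on, rule holomorphic_on_subset[OF hol]) auto
          show "norm (P N x - f x) \<le> B" if "norm (0 - x) = 1/2" for x
            using elim that by (force simp: dist_norm intro: less_imp_le)
        qed auto
        also have "(deriv ^^ n) (\<lambda>x. P N x - f x) 0 = (deriv ^^ n) (P N) 0 - (deriv ^^ n) f 0"
          by (rule higher_deriv_diff[OF holP holf]) auto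
        finally have *: "norm ((deriv ^^ n) (P N) 0 - (deriv ^^ n) f 0) \<le> fact n * (e / 2)"
          by (simp add: B_def)
        have "dist ((deriv ^^ n) (P N) 0 / fact n) ((deriv ^^ n) f 0 / fact n)
                = norm ((deriv ^^ n) (P N) 0 - (deriv ^^ n) f 0) / fact n"
          by (simp add: dist_norm norm_divide flip: diff_divide_distrib)
        also have "\<dots> \<le> e / 2"
          using * by (simp add: field_simps)
        also have "\<dots> < e" using e by simp
        finally show ?case .
      qed
    qed
    thus ?thesis
      by (rule closed_sequentially[OF closed_Ints integral_power_series_coeff[OF P]])
  qed
  have "f analytic_on {0}"
    using holf by (auto simp: analytic_at intro!: exI[of _ "ball 0 1"])
  hence "f has_fps_expansion fps_expansion f 0"
    by (rule analytic_at_imp_has_fps_expansion_0)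
  thus ?thesis
    using holf coeff by (auto simp: integral_power_series_def fps_expansion_def)
qed

definition euler_prod :: "nat \<Rightarrow> complex \<Rightarrow> complex" where
  "euler_prod m q = (\<Prod>n. 1 - (q ^ m) ^ Suc n)"

lemma euler_prod_uniform_limit:
  assumes m: "m > 0" and r: "0 < r" "r < 1"
  shows   "uniform_limit (cball 0 r) (\<lambda>N q. \<Prod>n<N. 1 - (q ^ m) ^ Suc n) (euler_prod m) sequentially"
proof -
  define S where "S = cball (0::complex) r"
  have le: "norm ((q ^ m) ^ Suc n) \<le> r ^ n" if "q \<in> S" for q n
  proof -
    have "norm q \<le> r" "norm q \<le> 1"
      using that r by (auto simp: S_def)
    have "norm ((q ^ m) ^ Suc n) = norm q ^ (m * Suc n)"
      by (simp only: norm_power power_mult)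
    also have "\<dots> \<le> norm q ^ n"
      using m \<open>norm q \<le> 1\<close> by (intro power_decreasing) (auto simp: trans_le_add2)
    also have "\<dots> \<le> r ^ n"
      using \<open>norm q \<le> r\<close> by (intro power_mono) auto
    finally show ?thesis .
  qed
  have "summable (\<lambda>n. r ^ n)"
    using r by (simp add: summable_geometric)
  hence conv: "uniformly_convergent_on S (\<lambda>N q. \<Sum>n<N. norm ((1 - (q ^ m) ^ Suc n) - 1))"
    by (intro Weierstrass_m_test'[where M = "\<lambda>n. r ^ n"]) (use le in auto)
  have "uniformly_convergent_on S (\<lambda>N q. \<Prod>n<N. 1 - (q ^ m) ^ Suc n)"
    by (rule uniformly_convergent_on_prod'[OF _ _ conv])
       (auto simp: S_def intro!: continuous_intros)
  then obtain L where L: "uniform_limit S (\<lambda>N q. \<Prod>n<N. 1 - (q ^ m) ^ Suc n) L sequentially"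
    by (auto simp: uniformly_convergent_on_def)
  have "L q = euler_prod m q" if "q \<in> S" for q
  proof -
    have "summable (\<lambda>n. norm ((1 - (q ^ m) ^ Suc n) - 1))"
      by (rule summable_comparison_test[OF _ \<open>summable (\<lambda>n. r ^ n)\<close>])
         (use le[OF that] in \<open>auto simp: norm_minus_commute\<close>)
    hence "convergent_prod (\<lambda>n. 1 - (q ^ m) ^ Suc n)"
      by (intro abs_convergent_prod_imp_convergent_prod summable_imp_abs_convergent_prod)
    hence "(\<lambda>N. \<Prod>n\<le>N. 1 - (q ^ m) ^ Suc n) \<longlonglongrightarrow> euler_prod m q"
      unfolding euler_prod_def by (rule convergent_prod_LIMSEQ)
    moreover have "(\<lambda>N. \<Prod>n<N. 1 - (q ^ m) ^ Suc n) \<longlonglongrightarrow> L q"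
      using L that by (rule tendsto_uniform_limitI)
    hence "(\<lambda>N. \<Prod>n\<le>N. 1 - (q ^ m) ^ Suc n) \<longlonglongrightarrow> L q"
      unfolding lessThan_Suc_atMost[symmetric] by (rule LIMSEQ_Suc)
    ultimately show ?thesis
      by (metis LIMSEQ_unique)
  qed
  thus ?thesis
    using L uniform_limit_cong'[of S "\<lambda>N q. \<Prod>n<N. 1 - (q ^ m) ^ Suc n"
                                 "\<lambda>N q. \<Prod>n<N. 1 - (q ^ m) ^ Suc n" L "euler_prod m"]
    unfolding S_def by blast
qed

lemma integral_power_series_euler_prod:
  assumes "m > 0"
  shows   "integral_power_series (euler_prod m)"
proof (rule integral_power_series_uniform_limit[OF _ euler_prod_uniform_limit[OF assms]])
  show "integral_power_series (\<lambda>q. \<Prod>n<N. 1 - (q ^ m) ^ Suc n)" for N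
    by (intro integral_power_series_prod integral_power_series_diff integral_power_series_const
          integral_power_series_power integral_power_series_ident) auto
qed

lemma dedekind_eta_multiple:
  "dedekind_eta (of_nat m * z) = exp (2 * of_real pi * \<i> * z / 24) ^ m * euler_prod m (nome z)"
proof -
  have "nome (of_nat m * z) = nome z ^ m"
    by (simp add: nome_def flip: exp_of_nat_mult) (simp add: mult_ac)
  thus ?thesis
    by (simp add: dedekind_eta_def euler_prod_def flip: exp_of_nat_mult) (simp add: mult_ac)
qed

lemma exp_power_24: "exp (2 * of_real pi * \<i> * z / 24) ^ 24 = nome z"
  by (simp add: nome_def flip: exp_of_nat_mult) (simp add: mult_ac)

lemma Delta_8_2_nome:
  "Delta_8_2 z = nome z * (euler_prod 1 (nome z) ^ 8 * euler_prod 2 (nome z) ^ 8)"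
proof -
  let ?e = "exp (2 * of_real pi * \<i> * z / 24)"
  have "Delta_8_2 z = ?e ^ 24 * (euler_prod 1 (nome z) ^ 8 * euler_prod 2 (nome z) ^ 8)"
    using dedekind_eta_multiple[of 1 z] dedekind_eta_multiple[of 2 z]
    by (simp add: Delta_8_2_def power_mult_distrib mult_ac flip: power_mult power_add)
  thus ?thesis by (simp only: exp_power_24)
qed

lemma Delta_8_3_nome:
  "Delta_8_3 z = nome z *
     (euler_prod 1 (nome z) ^ 12 * euler_prod 3 (nome z) ^ 4
      + 18 * nome z * euler_prod 1 (nome z) ^ 9 * euler_prod 3 (nome z) ^ 4 * euler_prod 9 (nome z) ^ 3
      + 81 * nome z ^ 2 * euler_prod 1 (nome z) ^ 6 * euler_prod 3 (nome z) ^ 4 * euler_prod 9 (nome z) ^ 6)"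
proof -
  define e where "e = exp (2 * of_real pi * \<i> * z / 24)"
  define A B C where "A = euler_prod 1 (nome z)" and "B = euler_prod 3 (nome z)"
    and "C = euler_prod 9 (nome z)"
  have "dedekind_eta z = e * A" "dedekind_eta (3 * z) = e ^ 3 * B" "dedekind_eta (9 * z) = e ^ 9 * C"
    using dedekind_eta_multiple[of 1 z] dedekind_eta_multiple[of 3 z] dedekind_eta_multiple[of 9 z]
    by (simp_all add: e_def A_def B_def C_def)
  hence "Delta_8_3 z = (e ^ 12 * (e ^ 3) ^ 4) * (A ^ 12 * B ^ 4)
           + (e ^ 9 * (e ^ 3) ^ 4 * (e ^ 9) ^ 3) * (18 * A ^ 9 * B ^ 4 * C ^ 3)
           + (e ^ 6 * (e ^ 3) ^ 4 * (e ^ 9) ^ 6) * (81 * A ^ 6 * B ^ 4 * C ^ 6)"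
    by (simp add: Delta_8_3_def power_mult_distrib mult_ac)
  also have "e ^ 12 * (e ^ 3) ^ 4 = e ^ 24"
    by (simp flip: power_mult power_add)
  also have "e ^ 9 * (e ^ 3) ^ 4 * (e ^ 9) ^ 3 = e ^ 24 * e ^ 24"
    by (simp flip: power_mult power_add)
  also have "e ^ 6 * (e ^ 3) ^ 4 * (e ^ 9) ^ 6 = e ^ 24 * (e ^ 24) ^ 2"
    by (simp flip: power_mult power_add)
  also have "e ^ 24 = nome z"
    unfolding e_def by (rule exp_power_24)
  finally show ?thesis
    by (simp add: A_def B_def C_def algebra_simps)
qed

lemma ex_q_expansion:
  assumes "integral_power_series g" "\<And>z. f z = nome z * g (nome z)"
  shows   "\<exists>a. has_q_expansion f a \<and> a 0 = 0"
proof -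
  have "integral_power_series (\<lambda>q. q * g q)"
    by (intro integral_power_series_mult integral_power_series_ident assms)
  then obtain a where a: "\<And>q. norm q < 1 \<Longrightarrow> (\<lambda>n. of_int (a n) * q ^ n) sums (q * g q)"
    using integral_power_series_sums by blast
  have "(\<lambda>n. of_int (a n) * 0 ^ n) sums (0 :: complex)"
    using a[of 0] by simp
  moreover have "(\<lambda>n. of_int (a n) * 0 ^ n) sums (of_int (a 0) :: complex)"
    by (rule powser_sums_zero)
  ultimately have "a 0 = 0"
    using sums_unique2 of_int_eq_0_iff by metis
  thus ?thesis
    using a assms(2) norm_nome_less_1 unfolding has_q_expansion_def by auto
qed

lemma tau_8_2_aux: "has_q_expansion Delta_8_2 tau_8_2 \<and> tau_8_2 0 = 0"
proof -
  have "\<exists>a. has_q_expansion Delta_8_2 a \<and> a 0 = 0"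
    by (rule ex_q_expansion[OF _ Delta_8_2_nome])
       (intro integral_power_series_mult integral_power_series_power
          integral_power_series_euler_prod; simp)
  then obtain a where a: "has_q_expansion Delta_8_2 a" "a 0 = 0"
    by blast
  have "tau_8_2 = a"
    unfolding tau_8_2_def
    using a(1) has_q_expansion_unique by (intro the_equality) auto
  thus ?thesis using a by simp
qed

lemma tau_8_3_aux: "has_q_expansion Delta_8_3 tau_8_3 \<and> tau_8_3 0 = 0"
proof -
  have "\<exists>a. has_q_expansion Delta_8_3 a \<and> a 0 = 0"
    by (rule ex_q_expansion[OF _ Delta_8_3_nome])
       (intro integral_power_series_mult integral_power_series_add integral_power_series_power
          integral_power_series_euler_prod integral_power_series_const integral_power_series_ident;
        simp)
  then obtain a where a: "has_q_expansion Delta_8_3 a" "a 0 = 0"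
    by blast
  have "tau_8_3 = a"
    unfolding tau_8_3_def
    using a(1) has_q_expansion_unique by (intro the_equality) auto
  thus ?thesis using a by simp
qed

lemma has_q_expansion_tau_8_2: "has_q_expansion Delta_8_2 tau_8_2"
  and tau_8_2_0: "tau_8_2 0 = 0"
  using tau_8_2_aux by blast+

lemma has_q_expansion_tau_8_3: "has_q_expansion Delta_8_3 tau_8_3"
  and tau_8_3_0: "tau_8_3 0 = 0"
  using tau_8_3_aux by blast+

end

theory Submission
  imports Defs
begin

text \<open>
  Both newforms are congruent to Eisenstein series, and the congruence can be read off from one
  value of a derivative of the Weierstrass function. Write the function $\wp$ of the lattice with
  nome $q$, as a function of $\zeta = z e^u$, as a Lambert series in $q$. Its sixth derivative at
  the point $z$ of order $N$ has coefficients $\sum_{d \mid n} d^7 (z^d + z^{-d})$. For $z = -1$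
  and $n$ odd this is $-2\sigma_7(n)$; for a primitive cube root of unity and $3 \nmid n$ it is
  $-\sigma_7(n)$. On the other hand the differential equation $\wp'' = 6\wp^2 - g_2/2$ makes the
  sixth derivative a polynomial in $\wp$, $\wp'$ and $\wp''$, and once denominators prime to $17$,
  respectively $41$, are cleared, this polynomial splits into a multiple of the cusp form and $17$,
  respectively $41$, times an integral series: these are the identities \<open>level2_identity\<close> and
  \<open>level3_identity\<close>. So the congruence with $\sigma_7(n)$ holds for every
  $n$ prime to the level, and prime powers are a special case.

  No modular forms are used; everything happens in the ring of power series in $q$ whose
  coefficients are power series in $u$. The analytic input is replaced by two identities between
  divisor sums. The square of the logarithmic derivative of the theta function gives the heat
  equation (\<open>zeta_square\<close>), and the square of $\wp$ gives its differential equation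
  (\<open>weierstrass_ode\<close>). Both follow by comparing coefficients from one bijection between the
  representations $n = md + ke$, a step of the Euclidean algorithm (\<open>quad_sum_euclid\<close>).

  To recognise the cusp forms, compare logarithmic derivatives: $q\,d/dq$ of an Euler product is
  the product times a divisor-sum series (\<open>XD_euler_fps\<close>), and a power series is determined by
  its logarithmic derivative and one coefficient (\<open>logderiv_unique\<close>). The heat equation and the
  differential equation together provide the $q$-derivatives of the values at the point $z$, and
  the combination in question turns out to have the logarithmic derivative of the eta product.
  At level $2$ this is immediate. At level $3$ the values are the cubic theta functions
  $a$, $b^3$ and $c^3 = a^3 - b^3$; here $b^3$ and $c^3$ are eta quotients, and the cusp form is
  $a^2 b^3 c^3 / 27$. That this agrees with the given combination of three eta products amounts to
  $a\,\eta(3z) = \eta(z)^3 + 9\,\eta(9z)^3$ (\<open>cubic_a_euler\<close>). There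
  $a(q) - (b(q) + 3c(q^3))$ and $a(q^3) - (b(q) + c(q^3))$ satisfy a homogeneous linear system
  of differential equations, whose solutions vanish as soon as they vanish to first order.
\<close>

section \<open>Sums over the representations of n as m d + k e\<close>

text \<open>The summands carry the whole quadruple, and not just the two divisors \<open>d\<close> and \<open>e\<close>, so that the
Euclidean step below can be formulated as a change of variables.\<close>

definition quad_sum ::
  "nat \<Rightarrow> (nat \<Rightarrow> nat \<Rightarrow> nat \<Rightarrow> nat \<Rightarrow> bool) \<Rightarrow> (nat \<Rightarrow> nat \<Rightarrow> nat \<Rightarrow> nat \<Rightarrow> 'a::comm_ring_1) \<Rightarrow> 'a" where
  "quad_sum n P F = (\<Sum>(m, d, k, e) \<in> {(m, d, k, e). 0 < m \<and> 0 < d \<and> 0 < k \<and> 0 < e \<and>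
                    m * d + k * e = n \<and> P m d k e}. F m d k e)"

lemma finite_quads: "finite {(m, d, k, e). 0 < m \<and> 0 < d \<and> 0 < k \<and> 0 < e \<and>
                    m * d + k * e = (n::nat) \<and> P m d k e}" (is "finite ?A")
proof (rule finite_subset)
  show "?A \<subseteq> {..n} \<times> {..n} \<times> {..n} \<times> {..n}"
    by (auto intro: trans_le_add1 trans_le_add2)
qed auto

lemma quad_sum_cong:
  assumes "\<And>m d k e. 0 < m \<Longrightarrow> 0 < d \<Longrightarrow> 0 < k \<Longrightarrow> 0 < e \<Longrightarrow> m * d + k * e = n \<Longrightarrow> P m d k e = Q m d k e"
    and "\<And>m d k e. 0 < m \<Longrightarrow> 0 < d \<Longrightarrow> 0 < k \<Longrightarrow> 0 < e \<Longrightarrow> m * d + k * e = n \<Longrightarrow> Q m d k e \<Longrightarrow> F m d k e = G m d k e"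
  shows "quad_sum n P F = quad_sum n Q G"
  unfolding quad_sum_def by (rule sum.cong) (use assms in auto)

lemma quad_sum_diff: "quad_sum n P (\<lambda>m d k e. F m d k e - G m d k e) = quad_sum n P F - quad_sum n P G"
  unfolding quad_sum_def by (simp add: sum_subtractf case_prod_unfold)

lemma quad_sum_refine:
  "quad_sum n P F = quad_sum n (\<lambda>m d k e. P m d k e \<and> Q m d k e) F + quad_sum n (\<lambda>m d k e. P m d k e \<and> \<not> Q m d k e) F"
  unfolding quad_sum_def by (subst sum.union_disjoint[symmetric, OF finite_quads finite_quads]) (auto intro!: sum.cong)

lemma quad_sum_split:
  "quad_sum n (\<lambda>_ _ _ _. True) F = quad_sum n P F + quad_sum n (\<lambda>m d k e. \<not> P m d k e) F"
  using quad_sum_refine[of n "\<lambda>_ _ _ _. True" F P] by simp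

lemma quad_sum_swap: "quad_sum n P F = quad_sum n (\<lambda>m d k e. P k e m d) (\<lambda>m d k e. F k e m d)"
  unfolding quad_sum_def
  by (rule sum.reindex_bij_witness[where i = "\<lambda>(m, d, k, e). (k, e, m, d)" and j = "\<lambda>(m, d, k, e). (k, e, m, d)"]) auto

lemma quad_sum_flip: "quad_sum n P F = quad_sum n (\<lambda>m d k e. P d m e k) (\<lambda>m d k e. F d m e k)"
  unfolding quad_sum_def
  by (rule sum.reindex_bij_witness[where i = "\<lambda>(m, d, k, e). (d, m, e, k)" and j = "\<lambda>(m, d, k, e). (d, m, e, k)"])
     (auto simp: mult.commute)

text \<open>$md + ke = (m-k)d + k(d+e)$: the subtractive Euclidean step on the multipliers is an additive step
on the divisors, and it keeps the sum. This is the only nontrivial transformation; all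
convolution identities below are consequences.\<close>

lemma quad_sum_euclid:
  "quad_sum n (\<lambda>m d k e. k < m) F = quad_sum n (\<lambda>m d k e. d < e) (\<lambda>m d k e. F (m + k) d k (e - d))"
proof -
  have 1: "(m - k) * d + k * (d + e) = m * d + k * e" if "k < m" for m d k e :: nat
    using less_imp_add_positive[OF that] by (auto simp: algebra_simps)
  have 2: "(m + k) * d + k * (e - d) = m * d + k * e" if "d < e" for m d k e :: nat
    using less_imp_add_positive[OF that] by (auto simp: algebra_simps)
  show ?thesis
    unfolding quad_sum_def
    by (rule sum.reindex_bij_witness[where i = "\<lambda>(m, d, k, e). (m + k, d, k, e - d)"
          and j = "\<lambda>(m, d, k, e). (m - k, d, k, d + e)"]) (auto simp: 1 2)
qed

text \<open>If the multipliers agree then $n = m(d + e)$, so the diagonal is a sum over the divisors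
$N = d + e$ of \<open>n\<close>. These are the elementary terms that survive the cancellations.\<close>

lemma quad_sum_diagonal:
  assumes "n > 0"
  shows "quad_sum n (\<lambda>m d k e. m = k) F =
     (\<Sum>N | N dvd n. \<Sum>d = 1..<N. F (n div N) d (n div N) (N - d))"
proof -
  have "(\<Sum>N | N dvd n. \<Sum>d = 1..<N. F (n div N) d (n div N) (N - d)) =
     (\<Sum>(N, d)\<in>(SIGMA N:{N. N dvd n}. {1..<N}). F (n div N) d (n div N) (N - d))"
    using assms by (subst sum.Sigma) auto
  also have "\<dots> = quad_sum n (\<lambda>m d k e. m = k) F"
    unfolding quad_sum_def
    using assms
    by (intro sum.reindex_bij_witness[where j = "\<lambda>(N, d). (n div N, d, n div N, N - d)"
          and i = "\<lambda>(m, d, k, e). (d + e, d)"])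
       (auto simp: div_greater_zero_iff dvd_imp_le simp flip: distrib_left)
  finally show ?thesis ..
qed

lemma convolution_quad_sum:
  "(\<Sum>i = 1..<n. (\<Sum>d | d dvd i. u d) * (\<Sum>e | e dvd (n - i). v e)) =
     quad_sum n (\<lambda>_ _ _ _. True) (\<lambda>m d k e. u d * v e)"
proof -
  have "(\<Sum>i = 1..<n. (\<Sum>d | d dvd i. u d) * (\<Sum>e | e dvd (n - i). v e)) =
        (\<Sum>i = 1..<n. \<Sum>(d, e)\<in>{d. d dvd i} \<times> {e. e dvd (n - i)}. u d * v e)"
    by (simp add: sum_product sum.cartesian_product)
  also have "\<dots> = (\<Sum>(i, d, e)\<in>(SIGMA i:{1..<n}. {d. d dvd i} \<times> {e. e dvd (n - i)}). u d * v e)"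
    by (subst sum.Sigma) auto
  also have "\<dots> = quad_sum n (\<lambda>_ _ _ _. True) (\<lambda>m d k e. u d * v e)"
  proof -
    have "0 < d \<and> 0 < i div d" if "d dvd i" "0 < i" for d i :: nat
      using that by (auto elim!: dvdE)
    thus ?thesis
      unfolding quad_sum_def
      by (intro sum.reindex_bij_witness[where j = "\<lambda>(i, d, e). (i div d, d, (n - i) div e, e)"
            and i = "\<lambda>(m, d, k, e). (m * d, d, e)"]) auto
  qed
  finally show ?thesis .
qed

text \<open>The exchange of \<open>(m, d)\<close> and \<open>(k, e)\<close> folds a symmetric sum into the part \<open>d < e\<close> and the diagonal;
the next lemma folds the same sum with respect to the multipliers. The Euclidean step relates
the two results.\<close>

lemma quad_sum_by_divisor:
  fixes F :: "nat \<Rightarrow> nat \<Rightarrow> 'a::comm_ring_1"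
  assumes "\<And>d e. F d e = F e d"
  shows "quad_sum n (\<lambda>_ _ _ _. True) (\<lambda>m d k e. F d e) =
     2 * quad_sum n (\<lambda>m d k e. d < e) (\<lambda>m d k e. F d e) + quad_sum n (\<lambda>m d k e. d = e) (\<lambda>m d k e. F d e)"
proof -
  have "quad_sum n (\<lambda>_ _ _ _. True) (\<lambda>m d k e. F d e) =
     quad_sum n (\<lambda>m d k e. d < e) (\<lambda>m d k e. F d e) + (quad_sum n (\<lambda>m d k e. e < d) (\<lambda>m d k e. F d e)
     + quad_sum n (\<lambda>m d k e. d = e) (\<lambda>m d k e. F d e))"
    by (subst quad_sum_split[of n _ "\<lambda>m d k e. d < e"], subst (2) quad_sum_refine[where Q = "\<lambda>m d k e. e < d"])
       (auto intro!: arg_cong2[where f = "(+)"] quad_sum_cong)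
  moreover have "quad_sum n (\<lambda>m d k e. e < d) (\<lambda>m d k e. F d e) = quad_sum n (\<lambda>m d k e. d < e) (\<lambda>m d k e. F d e)"
    by (subst quad_sum_swap) (simp add: assms)
  ultimately show ?thesis by simp
qed

lemma quad_sum_by_multiplier:
  fixes F :: "nat \<Rightarrow> nat \<Rightarrow> 'a::comm_ring_1"
  assumes "\<And>d e. F d e = F e d"
  shows "quad_sum n (\<lambda>_ _ _ _. True) (\<lambda>m d k e. F d e) =
     2 * quad_sum n (\<lambda>m d k e. k < m) (\<lambda>m d k e. F d e) + quad_sum n (\<lambda>m d k e. m = k) (\<lambda>m d k e. F d e)"
proof -
  have "quad_sum n (\<lambda>_ _ _ _. True) (\<lambda>m d k e. F d e) =
     quad_sum n (\<lambda>m d k e. k < m) (\<lambda>m d k e. F d e) + (quad_sum n (\<lambda>m d k e. m < k) (\<lambda>m d k e. F d e)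
     + quad_sum n (\<lambda>m d k e. m = k) (\<lambda>m d k e. F d e))"
    by (subst quad_sum_split[of n _ "\<lambda>m d k e. k < m"], subst (2) quad_sum_refine[where Q = "\<lambda>m d k e. m < k"])
       (auto intro!: arg_cong2[where f = "(+)"] quad_sum_cong)
  moreover have "quad_sum n (\<lambda>m d k e. m < k) (\<lambda>m d k e. F d e) = quad_sum n (\<lambda>m d k e. k < m) (\<lambda>m d k e. F d e)"
    by (subst quad_sum_swap) (simp add: assms)
  ultimately show ?thesis by simp
qed

text \<open>The idea is to find a symmetric \<open>F\<close> with $F(d,e) - F(d,e-d) = W(d,e)$, where \<open>W\<close> is the
summand on the left. Folding the sum of \<open>F\<close> once by the divisors and once by the multipliers, and
applying the Euclidean step, expresses the sum of \<open>W\<close> by diagonal terms of \<open>F\<close>. Such an \<open>F\<close> is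
found by comparing the coefficients of $f(d+e)$, $f(e-d)$, $f(d)$, $f(e)$ and $f(0)$. On the
diagonal $d = e$ both functions agree, which leaves only the diagonal of the multipliers.\<close>

lemma convolution_weight4:
  fixes f :: "int \<Rightarrow> 'a::comm_ring_1"
  assumes even: "\<And>j. f (- j) = f j" and "n > 0"
  shows "quad_sum n (\<lambda>_ _ _ _. True) (\<lambda>m d k e. of_nat d * of_nat e *
            (f (int d + int e) + f (int d - int e) - 2 * f (int d) - 2 * f (int e) + 2 * f 0)) =
         (\<Sum>N | N dvd n. \<Sum>d = 1..<N. of_nat d * of_nat (N - d) * f (int N)
            - of_nat (N - d) * of_nat N * f (int d) - of_nat d * of_nat N * f (int (N - d))
            + (of_nat N ^ 2 - of_nat d * of_nat (N - d)) * f 0)"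
    (is "quad_sum n _ (\<lambda>m d k e. ?W d e) = ?R")
proof -
  define F where "F = (\<lambda>d e. of_nat d * of_nat e * f (int d + int e)
     - of_nat e * (of_nat d + of_nat e) * f (int d) - of_nat d * (of_nat d + of_nat e) * f (int e)
     + ((of_nat d + of_nat e) ^ 2 - of_nat d * of_nat e) * f 0)"
  have F_sym: "F d e = F e d" for d e
    by (simp add: F_def algebra_simps)
  have W_sym: "?W d e = ?W e d" for d e
    using even[of "int d - int e"] by (simp add: algebra_simps)
  have diff: "F d e - F d (e - d) = ?W d e" if "d < e" for d e
  proof -
    obtain c where c: "e = d + c" using less_imp_Suc_add[OF \<open>d < e\<close>] by auto
    show ?thesis
      using even[of "int c"] by (simp add: F_def c algebra_simps power2_eq_square)
  qed
  have diag: "?W d d = F d d" for d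
    by (simp add: F_def algebra_simps power2_eq_square)
  have "2 * quad_sum n (\<lambda>m d k e. d < e) (\<lambda>m d k e. F d e) + quad_sum n (\<lambda>m d k e. d = e) (\<lambda>m d k e. F d e) =
        2 * quad_sum n (\<lambda>m d k e. k < m) (\<lambda>m d k e. F d e) + quad_sum n (\<lambda>m d k e. m = k) (\<lambda>m d k e. F d e)"
    by (rule trans[OF quad_sum_by_divisor[symmetric] quad_sum_by_multiplier]) (rule F_sym)+
  also have "quad_sum n (\<lambda>m d k e. k < m) (\<lambda>m d k e. F d e) =
             quad_sum n (\<lambda>m d k e. d < e) (\<lambda>m d k e. F d (e - d))"
    by (rule quad_sum_euclid)
  finally have "2 * (quad_sum n (\<lambda>m d k e. d < e) (\<lambda>m d k e. F d e) -
      quad_sum n (\<lambda>m d k e. d < e) (\<lambda>m d k e. F d (e - d))) + quad_sum n (\<lambda>m d k e. d = e) (\<lambda>m d k e. F d e)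
      = quad_sum n (\<lambda>m d k e. m = k) (\<lambda>m d k e. F d e)"
    by (simp add: algebra_simps)
  also have "quad_sum n (\<lambda>m d k e. d < e) (\<lambda>m d k e. F d e) -
      quad_sum n (\<lambda>m d k e. d < e) (\<lambda>m d k e. F d (e - d)) = quad_sum n (\<lambda>m d k e. d < e) (\<lambda>m d k e. ?W d e)"
    unfolding quad_sum_diff[symmetric] by (intro quad_sum_cong diff) auto
  also have "quad_sum n (\<lambda>m d k e. d = e) (\<lambda>m d k e. F d e) = quad_sum n (\<lambda>m d k e. d = e) (\<lambda>m d k e. ?W d e)"
    by (intro quad_sum_cong) (auto simp only: diag)
  also have "2 * quad_sum n (\<lambda>m d k e. d < e) (\<lambda>m d k e. ?W d e) + quad_sum n (\<lambda>m d k e. d = e) (\<lambda>m d k e. ?W d e) =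
     quad_sum n (\<lambda>_ _ _ _. True) (\<lambda>m d k e. ?W d e)"
    by (rule quad_sum_by_divisor[symmetric]) (rule W_sym)
  also have "quad_sum n (\<lambda>m d k e. m = k) (\<lambda>m d k e. F d e) = ?R"
    unfolding quad_sum_diagonal[OF assms(2)]
    by (intro sum.cong refl) (auto simp: F_def of_nat_diff mult_ac power2_eq_square)
  finally show ?thesis .
qed

text \<open>Liouville's identity. Here the two terms are transformed separately: $f(d+e)$ becomes a sum of
$f(e)$ over \<open>d < e\<close>, and $f(d-e)$ a sum of $f(e)$ over \<open>k < m\<close>. These two differ only by
diagonal terms, because the complementary sums of $f(e)$ over \<open>m < k\<close> and over \<open>e < d\<close> agree: the
Euclidean step preserves \<open>d\<close>, and the two pairs may be exchanged.\<close>

lemma convolution_weight2: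
  fixes f :: "int \<Rightarrow> 'a::comm_ring_1"
  assumes even: "\<And>j. f (- j) = f j" and "n > 0"
  shows "quad_sum n (\<lambda>_ _ _ _. True) (\<lambda>m d k e. f (int d + int e) - f (int d - int e)) =
         (\<Sum>N | N dvd n. 2 * (\<Sum>j = 1..<N. f (int j)) + (of_nat N - 1) * f (int N)
            - (of_nat (n div N) - 1) * (2 * f (int N) + f 0))"
proof -
  define f' where "f' = (\<lambda>j::nat. f (int j))"
  let ?q = "quad_sum n"
  let ?T = "\<lambda>_ _ _ _. True"
  have 1: "?q ?T (\<lambda>m d k e. f (int d + int e)) =
     2 * ?q (\<lambda>m d k e. d < e) (\<lambda>m d k e. f' e) + ?q (\<lambda>m d k e. m = k) (\<lambda>m d k e. f' (d + e))"
    using quad_sum_by_multiplier[of "\<lambda>d e. f' (d + e)" n] quad_sum_euclid[of n "\<lambda>m d k e. f' (d + e)"]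
      quad_sum_cong[of n "\<lambda>m d k e. d < e" "\<lambda>m d k e. d < e" "\<lambda>m d k e. f' (d + (e - d))" "\<lambda>m d k e. f' e"]
    by (simp add: f'_def add.commute)
  have "?q (\<lambda>m d k e. d < e) (\<lambda>m d k e. f (int d - int e)) = ?q (\<lambda>m d k e. d < e) (\<lambda>m d k e. f' (e - d))"
  proof (rule quad_sum_cong)
    fix d e :: nat assume "d < e"
    thus "f (int d - int e) = f' (e - d)"
      using even[of "int d - int e"] by (simp add: f'_def of_nat_diff)
  qed auto
  also have "\<dots> = ?q (\<lambda>m d k e. k < m) (\<lambda>m d k e. f' e)"
    by (rule quad_sum_euclid[symmetric])
  finally have less: "?q (\<lambda>m d k e. d < e) (\<lambda>m d k e. f (int d - int e)) =
     ?q (\<lambda>m d k e. k < m) (\<lambda>m d k e. f' e)" .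
  have eq: "?q (\<lambda>m d k e. d = e) (\<lambda>m d k e. f (int d - int e)) = ?q (\<lambda>m d k e. d = e) (\<lambda>m d k e. f 0)"
    by (rule quad_sum_cong) auto
  have sym: "f (int d - int e) = f (int e - int d)" for d e
    using even[of "int d - int e"] by simp
  have 2: "?q ?T (\<lambda>m d k e. f (int d - int e)) =
     2 * ?q (\<lambda>m d k e. k < m) (\<lambda>m d k e. f' e) + ?q (\<lambda>m d k e. d = e) (\<lambda>m d k e. f 0)"
    by (subst quad_sum_by_divisor) (rule sym, simp only: less eq)
  have "?q (\<lambda>m d k e. k < m) (\<lambda>m d k e. f' d) = ?q (\<lambda>m d k e. d < e) (\<lambda>m d k e. f' d)"
    by (rule quad_sum_euclid)
  hence 3: "?q (\<lambda>m d k e. m < k) (\<lambda>m d k e. f' e) = ?q (\<lambda>m d k e. e < d) (\<lambda>m d k e. f' e)"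
    by (subst (1 2) quad_sum_swap)
  have 4: "?q ?T (\<lambda>m d k e. f' e) = ?q (\<lambda>m d k e. d < e) (\<lambda>m d k e. f' e) +
    (?q (\<lambda>m d k e. e < d) (\<lambda>m d k e. f' e) + ?q (\<lambda>m d k e. d = e) (\<lambda>m d k e. f' e))"
    by (subst quad_sum_split[of n _ "\<lambda>m d k e. d < e"], subst (2) quad_sum_refine[where Q = "\<lambda>m d k e. e < d"])
       (auto intro!: arg_cong2[where f = "(+)"] quad_sum_cong)
  have 5: "?q ?T (\<lambda>m d k e. f' e) = ?q (\<lambda>m d k e. k < m) (\<lambda>m d k e. f' e) +
    (?q (\<lambda>m d k e. m < k) (\<lambda>m d k e. f' e) + ?q (\<lambda>m d k e. m = k) (\<lambda>m d k e. f' e))"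
    by (subst quad_sum_split[of n _ "\<lambda>m d k e. k < m"], subst (2) quad_sum_refine[where Q = "\<lambda>m d k e. m < k"])
       (auto intro!: arg_cong2[where f = "(+)"] quad_sum_cong)
  \<comment> \<open>subtract two partitions of the same sum of \<open>f' e\<close>; the parts \<open>m < k\<close> and \<open>e < d\<close> cancel\<close>
  have 6: "?q (\<lambda>m d k e. d < e) (\<lambda>m d k e. f' e) - ?q (\<lambda>m d k e. k < m) (\<lambda>m d k e. f' e) =
     ?q (\<lambda>m d k e. m = k) (\<lambda>m d k e. f' e) - ?q (\<lambda>m d k e. d = e) (\<lambda>m d k e. f' e)"
    using 3 4 5 by (simp add: algebra_simps)
  have A: "?q (\<lambda>m d k e. m = k) (\<lambda>m d k e. f' (d + e)) = (\<Sum>N | N dvd n. (of_nat N - 1) * f' N)"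
    unfolding quad_sum_diagonal[OF assms(2)]
  proof (rule sum.cong, goal_cases)
    case (2 N)
    hence "N \<ge> 1" using assms(2) by (auto intro!: Nat.gr0I)
    thus ?case by (simp add: of_nat_diff)
  qed auto
  have B: "?q (\<lambda>m d k e. m = k) (\<lambda>m d k e. f' e) = (\<Sum>N | N dvd n. (\<Sum>j = 1..<N. f' j))"
    unfolding quad_sum_diagonal[OF assms(2)]
  proof (rule sum.cong, goal_cases)
    case (2 N)
    show ?case
      by (rule sum.reindex_bij_witness[where i = "\<lambda>j. N - j" and j = "\<lambda>j. N - j"]) auto
  qed auto
  have C: "?q (\<lambda>m d k e. d = e) (\<lambda>m d k e. h d) = (\<Sum>N | N dvd n. (of_nat (n div N) - 1) * h N)" for h :: "nat \<Rightarrow> 'a"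
  proof -
    have "?q (\<lambda>m d k e. d = e) (\<lambda>m d k e. h d) = ?q (\<lambda>m d k e. m = k) (\<lambda>m d k e. h m)"
      by (rule quad_sum_flip)
    also have "\<dots> = (\<Sum>N | N dvd n. (of_nat N - 1) * h (n div N))"
      unfolding quad_sum_diagonal[OF assms(2)]
    proof (rule sum.cong, goal_cases)
      case (2 N)
      hence "N \<ge> 1" using assms(2) by (auto intro!: Nat.gr0I)
      thus ?case by (simp add: of_nat_diff)
    qed auto
    also have "\<dots> = (\<Sum>N | N dvd n. (of_nat (n div N) - 1) * h N)"
      using assms(2)
      by (intro sum.reindex_bij_witness[where i = "\<lambda>N. n div N" and j = "\<lambda>N. n div N"])
         auto
    finally show ?thesis .
  qed
  have C1: "?q (\<lambda>m d k e. d = e) (\<lambda>m d k e. f' e) = ?q (\<lambda>m d k e. d = e) (\<lambda>m d k e. f' d)"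
    by (rule quad_sum_cong) auto
  have "?q ?T (\<lambda>m d k e. f (int d + int e) - f (int d - int e)) =
     2 * (?q (\<lambda>m d k e. m = k) (\<lambda>m d k e. f' e) - ?q (\<lambda>m d k e. d = e) (\<lambda>m d k e. f' e)) +
     ?q (\<lambda>m d k e. m = k) (\<lambda>m d k e. f' (d + e)) - ?q (\<lambda>m d k e. d = e) (\<lambda>m d k e. f 0)"
    by (simp only: quad_sum_diff 1 2 6[symmetric]) (simp add: algebra_simps)
  also have "\<dots> = 2 * ((\<Sum>N | N dvd n. \<Sum>j = 1..<N. f' j) - (\<Sum>N | N dvd n. (of_nat (n div N) - 1) * f' N)) +
     (\<Sum>N | N dvd n. (of_nat N - 1) * f' N) - (\<Sum>N | N dvd n. (of_nat (n div N) - 1) * f 0)"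
    by (simp only: A B C1 C[of f'] C[of "\<lambda>_. f 0"])
  also have "\<dots> = (\<Sum>N | N dvd n. 2 * ((\<Sum>j = 1..<N. f' j) - (of_nat (n div N) - 1) * f' N) +
     (of_nat N - 1) * f' N - (of_nat (n div N) - 1) * f 0)"
    by (simp only: sum.distrib sum_subtractf sum_distrib_left[symmetric])
  finally show ?thesis
    by (simp add: f'_def algebra_simps)
qed

section \<open>Formal power series and Lambert series\<close>

definition lambert :: "'a \<Rightarrow> (nat \<Rightarrow> 'a) \<Rightarrow> 'a::comm_ring_1 fps" where
  "lambert c g = Abs_fps (\<lambda>n. if n = 0 then c else \<Sum>d | d dvd n. g d)"

lemma lambert_nth_0 [simp]: "fps_nth (lambert c g) 0 = c"
  by (simp add: lambert_def)

lemma lambert_nth [simp]: "n > 0 \<Longrightarrow> fps_nth (lambert c g) n = (\<Sum>d | d dvd n. g d)"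
  by (simp add: lambert_def)

lemma fps_square_nth:
  fixes A :: "'a::comm_ring_1 fps"
  assumes "n > 0"
  shows "fps_nth (A ^ 2) n = 2 * fps_nth A 0 * fps_nth A n + (\<Sum>i = 1..<n. fps_nth A i * fps_nth A (n - i))"
proof -
  have "{0..n} = insert 0 (insert n {1..<n})"
    using assms by auto
  thus ?thesis
    using assms by (simp add: power2_eq_square fps_mult_nth)
qed

lemma fps_XD_mult: "fps_XD (a * b) = fps_XD a * b + a * fps_XD (b :: 'a::comm_ring_1 fps)"
  by (simp add: fps_XD_def algebra_simps)

lemma fps_XD_diff: "fps_XD (a - b) = fps_XD a - fps_XD (b :: 'a::comm_ring_1 fps)"
  by (simp add: fps_XD_def algebra_simps)

lemma fps_XD_numeral [simp]: "fps_XD (numeral k :: 'a::comm_ring_1 fps) = 0"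
  by (simp add: fps_XD_def)

lemma numeral_mult_nth [simp]: "fps_nth (numeral k * F) n = numeral k * fps_nth (F :: 'a::comm_ring_1 fps) n"
  by (simp add: numeral_fps_const)

lemma numeral_nth_pos [simp]: "n > 0 \<Longrightarrow> fps_nth (numeral k :: 'a::comm_ring_1 fps) n = 0"
  by (simp add: numeral_fps_const)

lemma fps_XD_0 [simp]: "fps_XD 0 = 0"
  by (simp add: fps_XD_def)

lemma fps_square_nth_1: "fps_nth (F ^ 2) 1 = 2 * fps_nth F 0 * fps_nth (F :: 'a::comm_ring_1 fps) 1"
  by (subst fps_square_nth) auto

section \<open>Trigonometric functions at a root of unity\<close>

text \<open>The power $\zeta^j$ of $\zeta = z e^u$, expanded in \<open>u\<close>. Working near a fixed number \<open>z\<close> makes the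
rational functions of $\zeta$ with pole at $\zeta = 1$ into power series.\<close>

definition twist :: "complex \<Rightarrow> int \<Rightarrow> complex fps" where
  "twist z j = fps_const (z powi j) * fps_exp (of_int j)"

definition twist_even :: "complex \<Rightarrow> int \<Rightarrow> complex fps" where
  "twist_even z j = twist z j + twist z (- j)"

definition twist_odd :: "complex \<Rightarrow> int \<Rightarrow> complex fps" where
  "twist_odd z j = twist z j - twist z (- j)"

text \<open>$\frac12\,\frac{1+\zeta}{1-\zeta}$, the constant term in \<open>q\<close> of the zeta function; up to a factor
it is the cotangent of half the argument of $\zeta$.\<close>

definition twist_cot :: "complex \<Rightarrow> complex fps" where
  "twist_cot z = fps_const (1 / 2) * (1 + twist z 1) * inverse (1 - twist z 1)"

lemma twist_0 [simp]: "twist z 0 = 1"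
  by (simp add: twist_def)

lemma twist_add: "z \<noteq> 0 \<Longrightarrow> twist z (i + j) = twist z i * twist z j"
  by (simp add: twist_def power_int_add fps_exp_add_mult flip: fps_const_mult)

lemma twist_nth_0: "fps_nth (twist z j) 0 = z powi j"
  by (simp add: twist_def)

lemma deriv_twist: "fps_deriv (twist z j) = of_int j * twist z j"
  by (simp add: twist_def flip: fps_of_int)

lemma deriv_twist_even: "fps_deriv (twist_even z j) = of_int j * twist_odd z j"
  by (simp add: twist_even_def twist_odd_def deriv_twist algebra_simps)

lemma deriv_twist_odd: "fps_deriv (twist_odd z j) = of_int j * twist_even z j"
  by (simp add: twist_even_def twist_odd_def deriv_twist algebra_simps)

lemma twist_even_minus: "twist_even z (- j) = twist_even z j"
  by (simp add: twist_even_def)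

lemma twist_even_0: "twist_even z 0 = 2"
  by (simp add: twist_even_def)

lemma twist_even_mult:
  "z \<noteq> 0 \<Longrightarrow> twist_even z i * twist_even z j = twist_even z (i + j) + twist_even z (i - j)"
  using twist_add[of z i j] twist_add[of z i "- j"] twist_add[of z "- i" j] twist_add[of z "- i" "- j"]
  by (simp add: twist_even_def algebra_simps)

lemma twist_odd_mult:
  "z \<noteq> 0 \<Longrightarrow> twist_odd z i * twist_odd z j = twist_even z (i + j) - twist_even z (i - j)"
  using twist_add[of z i j] twist_add[of z i "- j"] twist_add[of z "- i" j] twist_add[of z "- i" "- j"]
  by (simp add: twist_even_def twist_odd_def algebra_simps)

context
  fixes z :: complex
  assumes z: "z \<noteq> 0" "z \<noteq> 1"
begin

lemma one_minus_twist: "1 - twist z 1 \<noteq> 0"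
proof
  assume "1 - twist z 1 = 0"
  hence "fps_nth (1 - twist z 1) 0 = 0" by simp
  thus False using z by (simp add: twist_nth_0)
qed

lemma cot_eq: "2 * twist_cot z * (1 - twist z 1) = 1 + twist z 1"
proof -
  have "inverse (1 - twist z 1) * (1 - twist z 1) = 1"
    by (rule inverse_mult_eq_1) (use z in \<open>simp add: twist_nth_0\<close>)
  hence "2 * twist_cot z * (1 - twist z 1) = fps_const (1/2) * 2 * (1 + twist z 1)"
    by (simp add: twist_cot_def mult.assoc)
  also have "fps_const (1/2) * 2 = (1 :: complex fps)"
    by (simp add: numeral_fps_const)
  finally show ?thesis by simp
qed

lemma deriv_cot_eq: "fps_deriv (twist_cot z) * (1 - twist z 1) ^ 2 = twist z 1"
proof -
  have "fps_deriv (2 * twist_cot z * (1 - twist z 1)) = fps_deriv (1 + twist z 1)"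
    by (simp only: cot_eq)
  hence deriv: "2 * fps_deriv (twist_cot z) * (1 - twist z 1) - 2 * twist_cot z * twist z 1 = twist z 1"
    by (simp add: deriv_twist)
  have "2 * (fps_deriv (twist_cot z) * (1 - twist z 1) ^ 2) =
      (2 * fps_deriv (twist_cot z) * (1 - twist z 1) - 2 * twist_cot z * twist z 1) * (1 - twist z 1) + twist z 1 * (2 * twist_cot z * (1 - twist z 1))"
    by Groebner_Basis.algebra
  also have "\<dots> = 2 * twist z 1"
    unfolding deriv cot_eq by Groebner_Basis.algebra
  finally have "2 * (fps_deriv (twist_cot z) * (1 - twist z 1) ^ 2) = 2 * twist z 1" .
  thus ?thesis by simp
qed

text \<open>The constant term in \<open>q\<close> of $\wp$, up to the shift by $1/12$, as a polynomial in the cotangent. It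
makes all higher derivatives polynomials in the cotangent as well.\<close>

lemma deriv_cot: "4 * fps_deriv (twist_cot z) = 4 * twist_cot z ^ 2 - 1"
proof -
  have "(4 * fps_deriv (twist_cot z)) * (1 - twist z 1) ^ 2 = (4 * twist_cot z ^ 2 - 1) * (1 - twist z 1) ^ 2"
    using cot_eq deriv_cot_eq by Groebner_Basis.algebra
  thus ?thesis using one_minus_twist by simp
qed

lemma deriv2_cot: "fps_deriv (fps_deriv (twist_cot z)) = 2 * twist_cot z * fps_deriv (twist_cot z)"
proof -
  have "fps_deriv (4 * fps_deriv (twist_cot z)) = fps_deriv (4 * twist_cot z ^ 2 - 1)"
    by (simp only: deriv_cot)
  hence "4 * fps_deriv (fps_deriv (twist_cot z)) = 4 * (2 * twist_cot z * fps_deriv (twist_cot z))"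
    by (simp add: power2_eq_square algebra_simps)
  thus ?thesis
    by (subst (asm) mult_cancel_left) simp
qed

lemma deriv3_cot: "fps_deriv (fps_deriv (fps_deriv (twist_cot z))) = 6 * fps_deriv (twist_cot z) ^ 2 + fps_deriv (twist_cot z)"
proof -
  have "fps_deriv (fps_deriv (fps_deriv (twist_cot z))) =
        2 * fps_deriv (twist_cot z) ^ 2 + 2 * twist_cot z * fps_deriv (fps_deriv (twist_cot z))"
    by (simp add: deriv2_cot power2_eq_square algebra_simps)
  thus ?thesis using deriv2_cot deriv_cot by Groebner_Basis.algebra
qed

lemma twist_1_minus_1: "twist z 1 * twist z (- 1) = 1"
  using twist_add[OF z(1), of 1 "-1"] by simp

lemma deriv_cot_mult_even_1: "fps_deriv (twist_cot z) * (twist_even z 1 - 2) = 1"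
proof -
  have "fps_deriv (twist_cot z) * (twist_even z 1 - 2) = fps_deriv (twist_cot z) * (1 - twist z 1) ^ 2 * twist z (- 1)"
    using twist_1_minus_1 unfolding twist_even_def by Groebner_Basis.algebra
  thus ?thesis
    using deriv_cot_eq twist_1_minus_1 by simp
qed

lemma deriv_cot_mult_even_Suc:
  "fps_deriv (twist_cot z) * (twist_even z (int (Suc N)) - twist_even z (int N)) = (\<Sum>j = 1..N. twist_even z (int j)) + 1"
proof (induction N)
  case 0
  show ?case using deriv_cot_mult_even_1 by (simp add: twist_even_0)
next
  case (Suc N)
  have "twist_even z (int (Suc (Suc N))) + twist_even z (int N) = twist_even z (int (Suc N)) * twist_even z 1"
    using twist_even_mult[OF z(1), of "int (Suc N)" 1] by (simp add: algebra_simps)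
  hence "fps_deriv (twist_cot z) * (twist_even z (int (Suc (Suc N))) - twist_even z (int (Suc N))) =
     fps_deriv (twist_cot z) * (twist_even z (int (Suc N)) - twist_even z (int N)) + twist_even z (int (Suc N)) * (fps_deriv (twist_cot z) * (twist_even z 1 - 2))"
    by Groebner_Basis.algebra
  thus ?case
    using Suc.IH deriv_cot_mult_even_1 by simp
qed

text \<open>The product of $\zeta/(1-\zeta)^2$ with $\zeta^N - 2 + \zeta^{-N}$ is the Fejer kernel: its second
difference in \<open>N\<close> is $\zeta^N + \zeta^{-N}$. It gives the mixed terms between the constant
and the higher terms of $\wp$ in its square.\<close>

lemma deriv_cot_mult_even:
  "fps_deriv (twist_cot z) * (twist_even z (int N) - 2) = (\<Sum>j = 1..<N. of_nat (N - j) * twist_even z (int j)) + of_nat N"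
proof (induction N)
  case 0
  show ?case by (simp add: twist_even_0)
next
  case (Suc N)
  have "(\<Sum>j = 1..<Suc N. of_nat (Suc N - j) * twist_even z (int j)) =
        (\<Sum>j = 1..N. of_nat (N - j) * twist_even z (int j) + twist_even z (int j))"
    by (intro sum.cong) (auto simp: Suc_diff_le algebra_simps)
  also have "\<dots> = (\<Sum>j = 1..N. of_nat (N - j) * twist_even z (int j)) + (\<Sum>j = 1..N. twist_even z (int j))"
    by (rule sum.distrib)
  also have "(\<Sum>j = 1..N. of_nat (N - j) * twist_even z (int j)) = (\<Sum>j = 1..<N. of_nat (N - j) * twist_even z (int j))"
    by (rule sum.mono_neutral_right) auto
  finally show ?case
    using Suc.IH deriv_cot_mult_even_Suc[of N] by (simp add: algebra_simps)
qed

text \<open>The Dirichlet kernel, which plays the same part for the square of the zeta function.\<close>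

lemma cot_mult_odd:
  assumes "N > 0"
  shows "2 * twist_cot z * twist_odd z (int N) = - (2 + 2 * (\<Sum>j = 1..<N. twist_even z (int j)) + twist_even z (int N))"
proof -
  have step: "2 * twist_cot z * (twist_odd z (int (Suc N)) - twist_odd z (int N)) = - (twist_even z (int N) + twist_even z (int (Suc N)))" for N
  proof -
    have "twist z (int N + 1) = twist z (int N) * twist z 1"
      by (rule twist_add[OF z(1)])
    moreover have "twist z (- int N) = twist z (- int N - 1) * twist z 1"
      using twist_add[OF z(1), of "- int N - 1" 1] by simp
    ultimately show ?thesis
      using cot_eq unfolding twist_odd_def twist_even_def
      by (simp only: of_nat_Suc minus_add_distrib add.commute[of 1] diff_conv_add_uminus)
         Groebner_Basis.algebra
  qed
  show ?thesis using assms
  proof (induction N rule: nat_induct_non_zero)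
    case 1
    show ?case
      using step[of 0] by (simp add: twist_even_0 twist_odd_def[of z 0])
  next
    case (Suc N)
    have "{1..<Suc N} = insert N {1..<N}" using Suc.hyps by auto
    hence "(\<Sum>j = 1..<Suc N. twist_even z (int j)) = twist_even z (int N) + (\<Sum>j = 1..<N. twist_even z (int j))"
      by simp
    thus ?case
      using Suc.IH step[of N] by Groebner_Basis.algebra
  qed
qed

end

section \<open>The Weierstrass function as a Lambert series\<close>

text \<open>The derivative with respect to the inner variable \<open>u\<close>, applied to each coefficient in \<open>q\<close>.\<close>

definition du :: "complex fps fps \<Rightarrow> complex fps fps" where
  "du F = Abs_fps (\<lambda>n. fps_deriv (fps_nth F n))"

lemma du_nth [simp]: "fps_nth (du F) n = fps_deriv (fps_nth F n)"
  by (simp add: du_def)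

lemma du_add [simp]: "du (F + G) = du F + du G"
  by (simp add: fps_eq_iff)

lemma du_diff [simp]: "du (F - G) = du F - du G"
  by (simp add: fps_eq_iff)

lemma fps_deriv_of_nat_mult: "fps_deriv (of_nat d * F) = of_nat d * fps_deriv (F :: complex fps)"
  by (simp flip: fps_of_nat)

lemma du_mult [simp]: "du (F * G) = F * du G + du F * G"
proof (rule fps_ext)
  fix n show "fps_nth (du (F * G)) n = fps_nth (F * du G + du F * G) n"
    by (simp only: du_nth fps_mult_nth fps_deriv_sum fps_add_nth fps_deriv_mult sum.distrib)
qed

lemma du_numeral [simp]: "du (numeral k) = 0"
  by (simp add: fps_eq_iff numeral_fps_const)

lemma du_XD: "du (fps_XD F) = fps_XD (du F)"
proof (rule fps_ext)
  fix n show "fps_nth (du (fps_XD F)) n = fps_nth (fps_XD (du F)) n"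
    by (simp flip: fps_of_nat)
qed

lemma du_lambert: "du (lambert c g) = lambert (fps_deriv c) (\<lambda>d. fps_deriv (g d))"
  by (rule fps_ext) (simp add: lambert_def fps_deriv_sum)

text \<open>The negative of the logarithmic derivative with respect to \<open>u\<close> of the theta function
$(\zeta^{1/2} - \zeta^{-1/2}) \prod_n (1-q^n)(1-q^n\zeta)(1-q^n\zeta^{-1})$. Up to
sign and a term linear in $\log \zeta$ it is the Weierstrass zeta function.\<close>

definition zeta_series :: "complex \<Rightarrow> complex fps fps" where
  "zeta_series z = lambert (twist_cot z) (\<lambda>d. twist_odd z (int d))"

text \<open>$E_2/12$, the amount by which the \<open>u\<close>-derivative of the zeta series differs from $\wp$.\<close>

definition eis2 :: "complex fps fps" where
  "eis2 = lambert (fps_const (1 / 12)) (\<lambda>d. - 2 * of_nat d)"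

text \<open>$E_4/240$, so that \<open>10 * eis4\<close> is half the invariant $g_2$.\<close>

definition eis4 :: "complex fps fps" where
  "eis4 = lambert (fps_const (1 / 240)) (\<lambda>d. of_nat d ^ 3)"

text \<open>The negative of the logarithmic derivative with respect to \<open>q\<close> of the same theta function.\<close>

definition log_theta :: "complex \<Rightarrow> complex fps fps" where
  "log_theta z = Abs_fps (\<lambda>n. \<Sum>d | d dvd n. of_nat (n div d) * twist_even z (int d) + of_nat d)"

lemma du_eis2 [simp]: "du eis2 = 0"
  unfolding eis2_def du_lambert by (simp add: lambert_def fps_eq_iff flip: fps_of_nat)

lemma du_eis4 [simp]: "du eis4 = 0"
  unfolding eis4_def du_lambert by (simp add: lambert_def fps_eq_iff fps_deriv_power flip: fps_of_nat)

text \<open>Equality of the mixed second derivatives of the logarithm of the theta function.\<close>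

lemma du_log_theta: "du (log_theta z) = fps_XD (zeta_series z)"
proof (rule fps_ext)
  fix n
  show "fps_nth (du (log_theta z)) n = fps_nth (fps_XD (zeta_series z)) n"
  proof (cases "n = 0")
    case False
    have "fps_deriv (of_nat (n div d) * twist_even z (int d) + of_nat d) = of_nat n * twist_odd z (int d)"
      if "d dvd n" for d
    proof -
      have "fps_deriv (of_nat (n div d) * twist_even z (int d) + of_nat d) =
            of_nat (n div d) * (of_nat d * twist_odd z (int d))"
        by (simp add: deriv_twist_even flip: fps_of_nat)
      also have "\<dots> = of_nat (n div d * d) * twist_odd z (int d)"
        by simp
      finally show ?thesis using that by simp
    qed
    thus ?thesis
      using False by (simp add: log_theta_def zeta_series_def fps_deriv_sum sum_distrib_left)
  qed (simp add: log_theta_def)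
qed

lemma du_zeta: "du (zeta_series z) = lambert (fps_deriv (twist_cot z)) (\<lambda>d. of_nat d * twist_even z (int d))"
  by (simp add: zeta_series_def du_lambert deriv_twist_odd)

lemma sum_of_nat: "2 * (\<Sum>j = 1..<N. of_nat j :: 'a::comm_ring_1) = of_nat N * (of_nat N - 1)"
  by (induction N) (auto simp: algebra_simps)

lemma sum_mult_complement:
  assumes "N > 0"
  shows "6 * (\<Sum>j = 1..<N. of_nat j * of_nat (N - j) :: 'a::comm_ring_1) = of_nat N ^ 3 - of_nat N"
  using assms
proof (induction N rule: nat_induct_non_zero)
  case (Suc N)
  have "(\<Sum>j = 1..<Suc N. of_nat j * of_nat (Suc N - j) :: 'a) =
        (\<Sum>j = 1..<Suc N. of_nat j * of_nat (N - j) + of_nat j)"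
    by (intro sum.cong) (auto simp: Suc_diff_le algebra_simps)
  also have "\<dots> = (\<Sum>j = 1..<Suc N. of_nat j * of_nat (N - j)) + (\<Sum>j = 1..<Suc N. of_nat j)"
    by (rule sum.distrib)
  also have "(\<Sum>j = 1..<Suc N. of_nat j * of_nat (N - j) :: 'a) = (\<Sum>j = 1..<N. of_nat j * of_nat (N - j))"
    by (rule sum.mono_neutral_right) (auto simp: less_Suc_eq)
  finally have "6 * (\<Sum>j = 1..<Suc N. of_nat j * of_nat (Suc N - j) :: 'a) =
     (of_nat N ^ 3 - of_nat N) + 3 * (of_nat (Suc N) * (of_nat (Suc N) - 1))"
    unfolding Suc.IH[symmetric] sum_of_nat[symmetric] by (simp add: algebra_simps)
  thus ?case
    by (simp add: algebra_simps power3_eq_cube)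
qed auto

context
  fixes z :: complex
  assumes z: "z \<noteq> 0" "z \<noteq> 1"
begin

text \<open>For the logarithm \<open>L\<close> of the theta function this is the heat equation
$2 \,q\partial_q L = \partial_u^2 L + (\partial_u L)^2 - \frac14$, which is Liouville's identity
for $f(j) = \zeta^j + \zeta^{-j}$.\<close>

lemma zeta_square: "4 * zeta_series z ^ 2 = 4 * du (zeta_series z) + 1 - 8 * log_theta z"
proof (rule fps_ext)
  fix n
  show "fps_nth (4 * zeta_series z ^ 2) n = fps_nth (4 * du (zeta_series z) + 1 - 8 * log_theta z) n"
  proof (cases "n = 0")
    case True
    thus ?thesis
      using deriv_cot[OF z] by (simp add: zeta_series_def log_theta_def fps_nth_power_0)
  next
    case False
    hence n: "n > 0" by simp
    have "(\<Sum>i = 1..<n. fps_nth (zeta_series z) i * fps_nth (zeta_series z) (n - i)) =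
          (\<Sum>i = 1..<n. (\<Sum>d | d dvd i. twist_odd z (int d)) * (\<Sum>e | e dvd (n - i). twist_odd z (int e)))"
      by (intro sum.cong) (auto simp: zeta_series_def)
    also have "\<dots> = quad_sum n (\<lambda>_ _ _ _. True) (\<lambda>m d k e. twist_even z (int d + int e) - twist_even z (int d - int e))"
      by (simp only: convolution_quad_sum twist_odd_mult[OF z(1)])
    also have "\<dots> = (\<Sum>N | N dvd n. 2 * (\<Sum>j = 1..<N. twist_even z (int j)) + (of_nat N - 1) * twist_even z (int N)
            - (of_nat (n div N) - 1) * (2 * twist_even z (int N) + twist_even z 0))"
      by (intro convolution_weight2 twist_even_minus n)
    finally have conv: "(\<Sum>i = 1..<n. fps_nth (zeta_series z) i * fps_nth (zeta_series z) (n - i)) = \<dots>" .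
    have "2 * twist_cot z * fps_nth (zeta_series z) n = (\<Sum>N | N dvd n. 2 * twist_cot z * twist_odd z (int N))"
      using n by (simp add: zeta_series_def sum_distrib_left)
    also have "\<dots> = (\<Sum>N | N dvd n. - (2 + 2 * (\<Sum>j = 1..<N. twist_even z (int j)) + twist_even z (int N)))"
      using n by (intro sum.cong cot_mult_odd[OF z]) (auto intro: dvd_pos_nat)
    finally have boundary: "2 * twist_cot z * fps_nth (zeta_series z) n = \<dots>" .
    have "fps_nth (zeta_series z ^ 2) n = (\<Sum>N | N dvd n. - (2 + 2 * (\<Sum>j = 1..<N. twist_even z (int j)) + twist_even z (int N)) +
        (2 * (\<Sum>j = 1..<N. twist_even z (int j)) + (of_nat N - 1) * twist_even z (int N)
            - (of_nat (n div N) - 1) * (2 * twist_even z (int N) + twist_even z 0)))"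
      unfolding sum.distrib conv[symmetric] boundary[symmetric]
      using n by (simp add: fps_square_nth zeta_series_def)
    also have "\<dots> = (\<Sum>N | N dvd n. of_nat N * twist_even z (int N) - 2 * (of_nat (n div N) * twist_even z (int N)) - 2 * of_nat (n div N))"
      by (simp add: twist_even_0 algebra_simps)
    also have "\<dots> = (\<Sum>N | N dvd n. of_nat N * twist_even z (int N)) -
        2 * (\<Sum>N | N dvd n. of_nat (n div N) * twist_even z (int N)) - 2 * (\<Sum>N | N dvd n. of_nat (n div N))"
      by (simp only: sum_subtractf sum_distrib_left)
    also have "(\<Sum>N | N dvd n. of_nat (n div N)) = (\<Sum>N | N dvd n. of_nat N :: complex fps)"
      using n by (intro sum.reindex_bij_witness[where i = "\<lambda>N. n div N" and j = "\<lambda>N. n div N"]) auto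
    finally have "fps_nth (zeta_series z ^ 2) n = (\<Sum>N | N dvd n. of_nat N * twist_even z (int N)) -
        2 * (\<Sum>N | N dvd n. of_nat (n div N) * twist_even z (int N)) - 2 * (\<Sum>N | N dvd n. of_nat N)" .
    thus ?thesis
      using n by (simp only: fps_add_nth fps_sub_nth numeral_mult_nth) (simp add: du_zeta log_theta_def sum.distrib algebra_simps)
  qed
qed

text \<open>The differential equation $\wp'' = 6\wp^2 - g_2/2$. On coefficients it is \<open>convolution_weight4\<close> for $f(j) = \zeta^j + \zeta^{-j}$, since
$(f(d) - 2)(f(e) - 2) = f(d+e) + f(d-e) - 2f(d) - 2f(e) + 4$. The multiples of
$\sum_j (N-j) f(j)$ cancel against the mixed terms.\<close>

lemma weierstrass_ode: "du (du (du (zeta_series z))) = 6 * (du (zeta_series z) + eis2) ^ 2 - 10 * eis4"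
proof (rule fps_ext)
  fix n
  define p where "p = fps_deriv (twist_cot z)"
  define W where "W = du (zeta_series z) + eis2"
  have W0: "fps_nth W 0 = p + fps_const (1 / 12)"
    by (simp add: W_def du_zeta eis2_def p_def)
  have c12: "12 * fps_const (1 / 12) = (1 :: complex fps)"
    by (simp add: numeral_fps_const)
  show "fps_nth (du (du (du (zeta_series z)))) n = fps_nth (6 * W ^ 2 - 10 * eis4) n"
  proof (cases "n = 0")
    case True
    have c240: "240 * fps_const (1 / 240) = (1 :: complex fps)"
      by (simp add: numeral_fps_const)
    have "24 * (6 * p ^ 2 + p) = 24 * (6 * (p + fps_const (1 / 12)) ^ 2 - 10 * fps_const (1 / 240))"
      using c12 c240 by Groebner_Basis.algebra
    hence "6 * p ^ 2 + p = 6 * (p + fps_const (1 / 12)) ^ 2 - 10 * fps_const (1 / 240)"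
      by (subst (asm) mult_cancel_left) simp
    thus ?thesis
      using True deriv3_cot[OF z]
      by (simp add: W0 fps_nth_power_0 eis4_def) (simp add: zeta_series_def p_def)
  next
    case False
    hence n: "n > 0" by simp
    have Wn: "fps_nth W i = (\<Sum>d | d dvd i. of_nat d * (twist_even z (int d) - 2))" if "i > 0" for i
      using that by (simp add: W_def du_zeta eis2_def algebra_simps flip: sum.distrib)
    have "(\<Sum>i = 1..<n. fps_nth W i * fps_nth W (n - i)) =
      (\<Sum>i = 1..<n. (\<Sum>d | d dvd i. of_nat d * (twist_even z (int d) - 2)) *
                   (\<Sum>e | e dvd (n - i). of_nat e * (twist_even z (int e) - 2)))"
      by (intro sum.cong) (auto simp: Wn)
    also have "\<dots> = quad_sum n (\<lambda>_ _ _ _. True)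
       (\<lambda>m d k e. of_nat d * (twist_even z (int d) - 2) * (of_nat e * (twist_even z (int e) - 2)))"
      by (rule convolution_quad_sum)
    also have "\<dots> = quad_sum n (\<lambda>_ _ _ _. True) (\<lambda>m d k e. of_nat d * of_nat e *
            (twist_even z (int d + int e) + twist_even z (int d - int e) - 2 * twist_even z (int d) - 2 * twist_even z (int e) + 2 * twist_even z 0))"
      by (intro quad_sum_cong) (auto simp: twist_even_0 twist_even_mult[OF z(1)] algebra_simps)
    also have "\<dots> = (\<Sum>N | N dvd n. \<Sum>d = 1..<N. of_nat d * of_nat (N - d) * twist_even z (int N)
            - of_nat (N - d) * of_nat N * twist_even z (int d) - of_nat d * of_nat N * twist_even z (int (N - d))
            + (of_nat N ^ 2 - of_nat d * of_nat (N - d)) * twist_even z 0)"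
      by (intro convolution_weight4 twist_even_minus n)
    finally have conv: "(\<Sum>i = 1..<n. fps_nth W i * fps_nth W (n - i)) = \<dots>" .
    have divisor: "of_nat N ^ 3 * twist_even z (int N) = 12 * fps_nth W 0 * (of_nat N * (twist_even z (int N) - 2)) +
       6 * (\<Sum>d = 1..<N. of_nat d * of_nat (N - d) * twist_even z (int N)
            - of_nat (N - d) * of_nat N * twist_even z (int d) - of_nat d * of_nat N * twist_even z (int (N - d))
            + (of_nat N ^ 2 - of_nat d * of_nat (N - d)) * twist_even z 0) - 10 * of_nat N ^ 3"
      if N: "N > 0" for N
    proof -
      define V where "V = (\<Sum>j = 1..<N. of_nat (N - j) * twist_even z (int j))"
      define T where "T = (\<Sum>j = 1..<N. of_nat j * of_nat (N - j) :: complex fps)"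
      define M where "M = (of_nat N :: complex fps)"
      have "(\<Sum>d = 1..<N. of_nat d * twist_even z (int (N - d))) = V"
        unfolding V_def
        by (rule sum.reindex_bij_witness[where i = "\<lambda>j. N - j" and j = "\<lambda>j. N - j"]) auto
      hence V': "(\<Sum>d = 1..<N. of_nat d * of_nat N * twist_even z (int (N - d))) = M * V"
        by (simp add: M_def sum_distrib_left mult_ac flip: \<open>_ = V\<close>)
      have V'': "(\<Sum>d = 1..<N. of_nat (N - d) * of_nat N * twist_even z (int d)) = M * V"
        by (simp add: M_def V_def sum_distrib_left mult_ac)
      have T': "(\<Sum>d = 1..<N. of_nat d * of_nat (N - d) * twist_even z (int N)) = T * twist_even z (int N)"
        by (simp add: T_def sum_distrib_right)
      have T'': "(\<Sum>d = 1..<N. (of_nat N ^ 2 - of_nat d * of_nat (N - d)) * twist_even z 0) = ((M - 1) * M ^ 2 - T) * 2"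
      proof -
        have "(\<Sum>d = 1..<N. (of_nat N ^ 2 - of_nat d * of_nat (N - d)) * twist_even z 0) =
              ((\<Sum>d = 1..<N. of_nat N ^ 2) - T) * 2"
          by (simp only: twist_even_0 T_def sum_subtractf sum_distrib_right[symmetric])
        thus ?thesis using N by (simp add: M_def of_nat_diff)
      qed
      have T6: "6 * T = M ^ 3 - M"
        unfolding T_def M_def by (rule sum_mult_complement[OF N])
      have pV: "p * (twist_even z (int N) - 2) = V + M"
        unfolding p_def V_def M_def by (rule deriv_cot_mult_even[OF z])
      show ?thesis
        unfolding sum.distrib sum_subtractf V' V'' T' T'' W0 unfolding M_def[symmetric]
        using T6 pV c12 by Groebner_Basis.algebra
    qed
    have "fps_nth (6 * W ^ 2 - 10 * eis4) n =
       12 * fps_nth W 0 * (\<Sum>N | N dvd n. of_nat N * (twist_even z (int N) - 2)) +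
       6 * (\<Sum>i = 1..<n. fps_nth W i * fps_nth W (n - i)) - 10 * (\<Sum>N | N dvd n. of_nat N ^ 3)"
      using n by (simp add: fps_square_nth Wn eis4_def algebra_simps)
    also have "\<dots> = (\<Sum>N | N dvd n. of_nat N ^ 3 * twist_even z (int N))"
      unfolding conv sum_distrib_left sum.distrib[symmetric] sum_subtractf[symmetric]
    proof (rule sum.cong, goal_cases)
      case (2 N)
      hence "N > 0" using n by (auto intro: dvd_pos_nat)
      thus ?case unfolding sum_distrib_left[symmetric] by (rule divisor[symmetric])
    qed auto
    also have "\<dots> = fps_nth (du (du (du (zeta_series z)))) n"
      using n by (simp add: du_zeta du_lambert deriv_twist_even deriv_twist_odd fps_deriv_of_nat_mult
                     power3_eq_cube mult_ac)
    finally show ?thesis ..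
  qed
qed

end

section \<open>Heat equation and Ramanujan differential equation\<close>

text \<open>The \<open>k\<close>-th derivative of $\wp - E_2/12$, thus for positive \<open>k\<close> the \<open>k\<close>-th derivative of $\wp$.\<close>

definition wp :: "complex \<Rightarrow> nat \<Rightarrow> complex fps fps" where
  "wp z k = (du ^^ Suc k) (zeta_series z)"

lemma du_zeta_series: "du (zeta_series z) = wp z 0"
  by (simp add: wp_def)

lemma du_wp: "du (wp z k) = wp z (Suc k)"
  by (simp add: wp_def)

lemma du_power2: "du (F ^ 2) = 2 * F * du F"
  by (simp add: power2_eq_square algebra_simps)

lemma cancel_numeral_fps:
  fixes F G :: "complex fps fps"
  shows "numeral k * F = numeral k * G \<Longrightarrow> F = G"
  by simp

context
  fixes z :: complex
  assumes z: "z \<noteq> 0" "z \<noteq> 1"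
begin

text \<open>The \<open>u\<close>-derivative of the heat equation; further derivatives follow.\<close>

lemma heat_zeta: "2 * fps_XD (zeta_series z) = wp z 1 - 2 * zeta_series z * wp z 0"
proof -
  have "du (4 * zeta_series z ^ 2) = du (4 * wp z 0 + 1 - 8 * log_theta z)"
    using zeta_square[OF z] by (simp only: du_zeta_series)
  moreover have "du (1 :: complex fps fps) = 0"
    using du_numeral[of Num.One] by (simp del: du_numeral)
  ultimately have "8 * (zeta_series z * wp z 0) = 4 * wp z 1 - 8 * fps_XD (zeta_series z)"
    by (simp add: du_power2 du_wp du_zeta_series du_log_theta)
  hence "4 * (2 * fps_XD (zeta_series z)) = 4 * (wp z 1 - 2 * zeta_series z * wp z 0)"
    by Groebner_Basis.algebra
  thus ?thesis by (rule cancel_numeral_fps)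
qed

lemma heat_wp_0: "2 * fps_XD (wp z 0) = wp z 2 - 2 * wp z 0 ^ 2 - 2 * zeta_series z * wp z 1"
proof -
  have "du (2 * fps_XD (zeta_series z)) = du (wp z 1 - 2 * zeta_series z * wp z 0)"
    by (simp only: heat_zeta)
  thus ?thesis
    by (simp add: du_XD du_zeta_series du_wp numeral_2_eq_2 algebra_simps)
qed

lemma heat_wp_1: "2 * fps_XD (wp z 1) = wp z 3 - 6 * wp z 0 * wp z 1 - 2 * zeta_series z * wp z 2"
proof -
  have "du (2 * fps_XD (wp z 0)) = du (wp z 2 - 2 * wp z 0 ^ 2 - 2 * zeta_series z * wp z 1)"
    by (simp only: heat_wp_0)
  thus ?thesis
    by (simp add: du_XD du_zeta_series du_wp du_power2 eval_nat_numeral algebra_simps)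
qed

lemma heat_wp_2: "2 * fps_XD (wp z 2) =
  wp z 4 - 8 * wp z 0 * wp z 2 - 6 * wp z 1 ^ 2 - 2 * zeta_series z * wp z 3"
proof -
  have "du (2 * fps_XD (wp z 1)) = du (wp z 3 - 6 * wp z 0 * wp z 1 - 2 * zeta_series z * wp z 2)"
    by (simp only: heat_wp_1)
  thus ?thesis
    by (simp add: du_XD du_zeta_series du_wp du_power2 eval_nat_numeral algebra_simps)
qed

lemma wp_2: "wp z 2 = 6 * (wp z 0 + eis2) ^ 2 - 10 * eis4"
  using weierstrass_ode[OF z] by (simp add: du_zeta_series du_wp numeral_2_eq_2)

lemma wp_3: "wp z 3 = 12 * (wp z 0 + eis2) * wp z 1"
proof -
  have "du (wp z 2) = du (6 * (wp z 0 + eis2) ^ 2 - 10 * eis4)"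
    by (simp only: wp_2)
  thus ?thesis
    by (simp add: du_wp du_power2 numeral_2_eq_2 numeral_3_eq_3)
qed

lemma wp_4: "wp z 4 = 12 * (wp z 0 + eis2) * wp z 2 + 12 * wp z 1 ^ 2"
proof -
  have "du (wp z 3) = du (12 * (wp z 0 + eis2) * wp z 1)"
    by (simp only: wp_3)
  thus ?thesis
    by (simp add: du_wp eval_nat_numeral algebra_simps)
qed

lemma wp_5: "wp z 5 = 12 * (wp z 0 + eis2) * wp z 3 + 36 * wp z 1 * wp z 2"
proof -
  have "du (wp z 4) = du (12 * (wp z 0 + eis2) * wp z 2 + 12 * wp z 1 ^ 2)"
    by (simp only: wp_4)
  thus ?thesis
    by (simp add: du_wp du_power2 eval_nat_numeral algebra_simps)
qed

lemma wp_6: "wp z 6 = 12 * (wp z 0 + eis2) * wp z 4 + 48 * wp z 1 * wp z 3 + 36 * wp z 2 ^ 2"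
proof -
  have "du (wp z 5) = du (12 * (wp z 0 + eis2) * wp z 3 + 36 * wp z 1 * wp z 2)"
    by (simp only: wp_5)
  thus ?thesis
    by (simp add: du_wp eval_nat_numeral algebra_simps)
qed

lemma wp_1_nonzero: "wp z 1 \<noteq> 0"
proof
  assume "wp z 1 = 0"
  hence "fps_nth (wp z 1) 1 = 0" by simp
  moreover have "fps_nth (wp z 1) 1 = twist_odd z 1"
    by (simp add: wp_def du_zeta deriv_twist_even)
  ultimately have "twist_odd z 1 = 0" by simp
  moreover from this have "twist_even z 1 = 0"
    using deriv_twist_odd[of z 1] by simp
  ultimately have "2 * twist z 1 = 0"
    by (simp add: twist_odd_def twist_even_def)
  thus False
    using z twist_nth_0[of z 1] by simp
qed

text \<open>Ramanujan's equation for the derivative of $E_2$ is the compatibility condition between the heat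
equation and the differential equation of $\wp$: applying $q\,d/dq$ to the latter yields an
expression for $\wp'^2$, and differentiating this with respect to \<open>u\<close> leaves a multiple of $\wp'$.\<close>

lemma ramanujan_eis2: "6 * fps_XD eis2 = 6 * eis2 ^ 2 - 10 * eis4"
proof -
  define p p1 p2 p3 p4 S B g where defs: "p = wp z 0" "p1 = wp z 1" "p2 = wp z 2" "p3 = wp z 3"
    "p4 = wp z 4" "S = zeta_series z" "B = eis2" "g = eis4"
  note defs' = defs[symmetric]
  have XDp2: "fps_XD p2 = 12 * (p + B) * (fps_XD p + fps_XD B) - 10 * fps_XD g"
  proof -
    have "fps_XD p2 = fps_XD (6 * (p + B) ^ 2 - 10 * g)"
      by (simp only: defs wp_2)
    thus ?thesis
      by (simp add: power2_eq_square fps_XD_mult fps_XD_diff algebra_simps)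
  qed
  \<comment> \<open>the terms with \<open>S\<close> and with the fourth derivative cancel\<close>
  have "2 * (3 * p1 ^ 2) = 2 * (4 * p * p2 - 12 * (p + B) * p ^ 2 + 12 * (p + B) * fps_XD B - 10 * fps_XD g)"
    using XDp2 heat_wp_2[unfolded defs'] heat_wp_0[unfolded defs'] wp_3[unfolded defs'] wp_4[unfolded defs']
    by Groebner_Basis.algebra
  hence "3 * p1 ^ 2 = 4 * p * p2 - 12 * (p + B) * p ^ 2 + 12 * (p + B) * fps_XD B - 10 * fps_XD g"
    by (rule cancel_numeral_fps)
  \<comment> \<open>apply \<open>du\<close>; the \<open>q\<close>-derivative of \<open>g\<close> is constant in \<open>u\<close> and disappears\<close>
  hence "du (3 * p1 ^ 2) = du (4 * p * p2 - 12 * (p + B) * p ^ 2 + 12 * (p + B) * fps_XD B - 10 * fps_XD g)"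
    by (simp only:)
  moreover have "du p = p1" "du p1 = p2" "du p2 = p3" "du B = 0" "du g = 0"
    by (simp_all add: defs du_wp eval_nat_numeral)
  ultimately have "6 * p1 * p2 = 4 * p1 * p2 + 4 * p * p3 - 12 * p1 * p ^ 2 - 24 * (p + B) * p * p1 + 12 * p1 * fps_XD B"
    by (simp add: du_power2 du_XD algebra_simps)
  hence "2 * (p1 * (6 * fps_XD B)) = 2 * (p1 * (6 * B ^ 2 - 10 * g))"
    using wp_3[unfolded defs'] wp_2[unfolded defs'] by Groebner_Basis.algebra
  hence "p1 * (6 * fps_XD B) = p1 * (6 * B ^ 2 - 10 * g)"
    by (rule cancel_numeral_fps)
  thus ?thesis
    using wp_1_nonzero unfolding defs by (subst (asm) mult_cancel_left) simp
qed

text \<open>The Eisenstein series of weight 4, which enters through Ramanujan's equation, is eliminated again by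
the differential equation of $\wp$. So the $q$-derivative of $\wp$ at a torsion point is a polynomial in
values at that point.\<close>

lemma XD_weierstrass: "3 * fps_XD (wp z 0 + eis2) =
  2 * wp z 2 - 6 * (wp z 0 + eis2) * wp z 0 - 3 * zeta_series z * wp z 1"
proof -
  have "2 * (3 * fps_XD (wp z 0 + eis2)) =
        2 * (2 * wp z 2 - 6 * (wp z 0 + eis2) * wp z 0 - 3 * zeta_series z * wp z 1)"
    unfolding fps_XD_add using heat_wp_0 ramanujan_eis2 wp_2 by Groebner_Basis.algebra
  thus ?thesis by (rule cancel_numeral_fps)
qed

end

section \<open>Specialisation at a torsion point\<close>

text \<open>Evaluation at \<open>u = 0\<close>, that is at $\zeta = z$.\<close>

definition at0 :: "complex fps fps \<Rightarrow> complex fps" where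
  "at0 F = Abs_fps (\<lambda>n. fps_nth (fps_nth F n) 0)"

lemma at0_nth [simp]: "fps_nth (at0 F) n = fps_nth (fps_nth F n) 0"
  by (simp add: at0_def)

lemma at0_add [simp]: "at0 (F + G) = at0 F + at0 G"
  by (simp add: fps_eq_iff)

lemma at0_diff [simp]: "at0 (F - G) = at0 F - at0 G"
  by (simp add: fps_eq_iff)

lemma at0_mult [simp]: "at0 (F * G) = at0 F * at0 G"
  by (rule fps_ext) (simp add: fps_mult_nth fps_sum_nth)

lemma at0_numeral [simp]: "at0 (numeral k) = numeral k"
  by (rule fps_ext) (simp add: numeral_fps_const)

lemma at0_1 [simp]: "at0 1 = 1"
  by (rule fps_ext) simp

lemma at0_power [simp]: "at0 (F ^ k) = at0 F ^ k"
  by (induction k) simp_all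

lemma at0_XD [simp]: "at0 (fps_XD F) = fps_XD (at0 F)"
  by (rule fps_ext) (simp flip: fps_of_nat)

lemma at0_lambert: "at0 (lambert c g) = lambert (fps_nth c 0) (\<lambda>d. fps_nth (g d) 0)"
  by (rule fps_ext) (simp add: lambert_def fps_sum_nth)

lemma wp_lambert:
  "wp z k = lambert ((fps_deriv ^^ Suc k) (twist_cot z))
     (\<lambda>d. of_nat d ^ Suc k * (if even k then twist_even z (int d) else twist_odd z (int d)))"
proof (induction k)
  case 0
  show ?case by (simp add: wp_def du_zeta)
next
  case (Suc k)
  have "fps_deriv (of_nat d ^ Suc k * F) = of_nat d ^ Suc k * fps_deriv F" for d and F :: "complex fps"
    unfolding of_nat_power[symmetric] by (rule fps_deriv_of_nat_mult)
  hence "fps_deriv (of_nat d ^ Suc k * (if even k then twist_even z (int d) else twist_odd z (int d))) =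
     of_nat d ^ Suc (Suc k) * (if even (Suc k) then twist_even z (int d) else twist_odd z (int d))" for d
    by (simp only:) (simp add: deriv_twist_even deriv_twist_odd mult_ac)
  thus ?case
    unfolding du_wp[symmetric] Suc.IH du_lambert by simp
qed

lemma at0_wp_nth:
  assumes "n > 0"
  shows "fps_nth (at0 (wp z k)) n = (\<Sum>d | d dvd n. of_nat d ^ Suc k * (z ^ d + (- 1) ^ k * inverse z ^ d))"
  using assms unfolding wp_lambert at0_lambert
  by (auto simp: twist_even_def twist_odd_def twist_nth_0 power_int_minus power_inverse fps_nth_power_0
           intro!: sum.cong simp flip: fps_of_nat)

lemma at0_zeta_nth:
  assumes "n > 0"
  shows "fps_nth (at0 (zeta_series z)) n = (\<Sum>d | d dvd n. z ^ d - inverse z ^ d)"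
  using assms unfolding zeta_series_def at0_lambert
  by (simp add: twist_odd_def twist_nth_0 power_int_minus power_inverse)

lemma at0_zeta_nth_0:
  assumes "z \<noteq> 1"
  shows "fps_nth (at0 (zeta_series z)) 0 = (1 + z) / (2 * (1 - z))"
  using assms by (simp add: zeta_series_def twist_cot_def twist_nth_0 field_simps)

lemma at0_wp_0_nth_0:
  assumes "z \<noteq> 0" "z \<noteq> 1"
  shows "fps_nth (at0 (wp z 0)) 0 = fps_nth (at0 (zeta_series z)) 0 ^ 2 - 1 / 4"
proof -
  have "fps_nth (4 * fps_deriv (twist_cot z)) 0 = fps_nth (4 * twist_cot z ^ 2 - 1) 0"
    using deriv_cot[OF assms] by simp
  hence "4 * fps_nth (fps_deriv (twist_cot z)) 0 = 4 * fps_nth (twist_cot z) 0 ^ 2 - 1"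
    by (simp only: numeral_mult_nth fps_sub_nth fps_nth_power_0 fps_one_nth simp_thms if_True)
  thus ?thesis
    by (simp add: wp_def zeta_series_def field_simps)
qed

lemma at0_wp_1_nth_0:
  assumes "z \<noteq> 0" "z \<noteq> 1"
  shows "fps_nth (at0 (wp z 1)) 0 = 2 * fps_nth (at0 (zeta_series z)) 0 * fps_nth (at0 (wp z 0)) 0"
proof -
  have "fps_deriv (fps_deriv (twist_cot z)) = 2 * twist_cot z * fps_deriv (twist_cot z)"
    by (rule deriv2_cot[OF assms])
  hence "fps_nth (fps_deriv (fps_deriv (twist_cot z))) 0 = fps_nth (2 * twist_cot z * fps_deriv (twist_cot z)) 0"
    by simp
  thus ?thesis
    by (simp only: mult.assoc numeral_mult_nth fps_mult_nth_0) (simp add: wp_def zeta_series_def)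
qed

lemma at0_wp_2_nth_0:
  assumes "z \<noteq> 0" "z \<noteq> 1"
  shows "fps_nth (at0 (wp z 2)) 0 = 6 * fps_nth (at0 (wp z 0)) 0 ^ 2 + fps_nth (at0 (wp z 0)) 0"
proof -
  have "fps_nth (fps_deriv (fps_deriv (fps_deriv (twist_cot z)))) 0 =
        fps_nth (6 * fps_deriv (twist_cot z) ^ 2 + fps_deriv (twist_cot z)) 0"
    using deriv3_cot[OF assms] by simp
  thus ?thesis
    by (simp only: numeral_mult_nth fps_add_nth fps_nth_power_0) (simp add: wp_def zeta_series_def numeral_2_eq_2)
qed

section \<open>Logarithmic derivatives and Euler products\<close>

text \<open>The difference \<open>H\<close> satisfies the same equation, whose coefficient at \<open>n\<close> reads $(n - k) H_n = 0$ once the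
lower coefficients vanish. So \<open>k\<close> is the only place where a coefficient can be chosen.\<close>

lemma logderiv_unique:
  fixes F G L :: "complex fps"
  assumes F: "fps_XD F = L * F" and G: "fps_XD G = L * G"
    and L: "fps_nth L 0 = of_nat k" and FG: "fps_nth F k = fps_nth G k"
  shows "F = G"
proof -
  define H where "H = F - G"
  have H: "fps_XD H = L * H"
    by (simp add: H_def fps_XD_diff F G algebra_simps)
  have "fps_nth H n = 0" for n
  proof (induction n rule: less_induct)
    case (less n)
    have "of_nat n * fps_nth H n = fps_nth (fps_XD H) n" by simp
    also have "\<dots> = (\<Sum>i=0..n. fps_nth L i * fps_nth H (n - i))"
      unfolding H by (rule fps_mult_nth)
    also have "\<dots> = (\<Sum>i\<in>{0}. fps_nth L i * fps_nth H (n - i))"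
      using less.IH by (intro sum.mono_neutral_right) auto
    finally have "(of_nat n - of_nat k) * fps_nth H n = 0"
      using L by (simp add: algebra_simps)
    thus ?case
      using FG by (cases "n = k") (auto simp: H_def)
  qed
  thus ?thesis
    by (simp add: H_def fps_eq_iff)
qed

lemma logderiv_mult:
  fixes F G :: "'a::comm_ring_1 fps"
  assumes "fps_XD F = L * F" "fps_XD G = M * G"
  shows "fps_XD (F * G) = (L + M) * (F * G)"
  by (simp add: fps_XD_mult assms algebra_simps)

lemma logderiv_power:
  fixes F :: "'a::comm_ring_1 fps"
  assumes "fps_XD F = L * F"
  shows "fps_XD (F ^ n) = (of_nat n * L) * F ^ n"
proof (induction n)
  case 0
  show ?case by (simp add: fps_XD_def)
next
  case (Suc n)
  show ?case
    unfolding power_Suc fps_XD_mult Suc.IH assms by (simp add: algebra_simps)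
qed

lemma XD_fps_X: "fps_XD fps_X = 1 * (fps_X :: 'a::comm_ring_1 fps)"
  by (simp add: fps_XD_def)

definition euler_fps :: "nat \<Rightarrow> complex fps" where
  "euler_fps m = fps_expansion (euler_prod m) 0"

text \<open>$\sum_n \sigma_1(n) q^{mn}$. At \<open>n = 0\<close> the sum ranges over the infinite set of all divisors of \<open>0\<close> and
has the default value \<open>0\<close>, which is the intended constant term.\<close>

definition sigma_fps :: "nat \<Rightarrow> complex fps" where
  "sigma_fps m = Abs_fps (\<lambda>n. if m dvd n then \<Sum>d | d dvd (n div m). of_nat d else 0)"

text \<open>$j q^j / (1 - q^j)$, the negative of the logarithmic derivative of $1 - q^j$.\<close>

definition geometric_fps :: "nat \<Rightarrow> complex fps" where
  "geometric_fps j = Abs_fps (\<lambda>n. if n > 0 \<and> j dvd n then of_nat j else 0)"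

lemma geometric_fps_eq:
  assumes "j > 0"
  shows "(1 - fps_X ^ j) * geometric_fps j = of_nat j * fps_X ^ j"
proof (rule fps_ext)
  fix n
  have dvd: "j dvd (n - j) \<longleftrightarrow> j dvd n" if "n > j" for n
    using that by (simp add: dvd_minus_self)
  show "fps_nth ((1 - fps_X ^ j) * geometric_fps j) n = fps_nth (of_nat j * fps_X ^ j) n"
    using assms dvd[of n]
    by (cases n j rule: linorder_cases)
       (auto simp: algebra_simps fps_X_power_mult_nth geometric_fps_def fps_of_nat[symmetric] dest: dvd_imp_le)
qed

lemma euler_fps_expansion:
  assumes "m > 0"
  shows "euler_prod m has_fps_expansion euler_fps m"
proof -
  have "euler_prod m holomorphic_on ball 0 1"
    using integral_power_series_euler_prod[OF assms] by (simp add: integral_power_series_def)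
  hence "euler_prod m analytic_on {0}"
    by (auto simp: analytic_at intro!: exI[of _ "ball 0 1"])
  thus ?thesis
    unfolding euler_fps_def by (rule analytic_at_imp_has_fps_expansion_0)
qed

definition euler_partial :: "nat \<Rightarrow> nat \<Rightarrow> complex fps" where
  "euler_partial m N = (\<Prod>n<N. 1 - fps_X ^ (m * Suc n))"

text \<open>Locally uniform convergence of the partial products gives convergence of each Taylor coefficient.\<close>

lemma euler_partial_tendsto:
  assumes m: "m > 0"
  shows "(\<lambda>N. fps_nth (euler_partial m N) k) \<longlonglongrightarrow> fps_nth (euler_fps m) k"
proof -
  define P where "P = (\<lambda>N q. \<Prod>n<N. 1 - (q ^ m) ^ Suc n :: complex)"
  have P: "P N has_fps_expansion euler_partial m N" for N
    unfolding P_def euler_partial_def power_mult[symmetric]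
    by (intro fps_expansion_intros)
  have "(\<lambda>N. (deriv ^^ k) (P N) 0) \<longlonglongrightarrow> (deriv ^^ k) (euler_prod m) 0"
  proof (rule higher_deriv_complex_uniform_limit)
    have "uniform_limit (cball 0 (1/2)) P (euler_prod m) sequentially"
      unfolding P_def using euler_prod_uniform_limit[OF m, of "1/2"] by simp
    thus "uniform_limit (ball 0 (1/2)) P (euler_prod m) sequentially"
      by (rule uniform_limit_on_subset) auto
    show "\<forall>\<^sub>F N in sequentially. P N holomorphic_on ball 0 (1/2)"
      unfolding P_def by (intro always_eventually allI holomorphic_intros)
  qed auto
  hence "(\<lambda>N. (deriv ^^ k) (P N) 0 / fact k) \<longlonglongrightarrow> (deriv ^^ k) (euler_prod m) 0 / fact k"
    by (intro tendsto_intros) auto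
  thus ?thesis
    using fps_nth_fps_expansion[OF P] fps_nth_fps_expansion[OF euler_fps_expansion[OF m]] by simp
qed

lemma XD_euler_partial:
  assumes m: "m > 0"
  shows "fps_XD (euler_partial m N) = - euler_partial m N * (\<Sum>n<N. geometric_fps (m * Suc n))"
proof (induction N)
  case 0
  show ?case by (simp add: euler_partial_def fps_XD_def)
next
  case (Suc N)
  define j where "j = m * Suc N"
  have j: "j > 0" using m by (simp add: j_def)
  have step: "euler_partial m (Suc N) = euler_partial m N * (1 - fps_X ^ j)"
    by (simp add: euler_partial_def j_def)
  have "fps_XD (1 - fps_X ^ j) = - (of_nat j * fps_X ^ j :: complex fps)"
    using j by (intro fps_ext) (simp flip: fps_of_nat)
  also have "\<dots> = - (1 - fps_X ^ j) * geometric_fps j"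
    by (simp only: geometric_fps_eq[OF j] mult_minus_left)
  finally have XD: "fps_XD (1 - fps_X ^ j) = - (1 - fps_X ^ j) * geometric_fps j" .
  show ?case
    unfolding step fps_XD_mult Suc.IH sum.lessThan_Suc j_def[symmetric] XD by Groebner_Basis.algebra
qed

lemma geometric_sum_nth:
  assumes m: "m > 0" and k: "k \<le> N"
  shows "fps_nth (\<Sum>n<N. geometric_fps (m * Suc n)) k = fps_nth (of_nat m * sigma_fps m) k"
proof (cases "k = 0")
  case True
  thus ?thesis by (simp add: fps_sum_nth geometric_fps_def sigma_fps_def fps_of_nat[symmetric])
next
  case False
  have "fps_nth (\<Sum>n<N. geometric_fps (m * Suc n)) k =
        (\<Sum>n<N. if m * Suc n dvd k then of_nat (m * Suc n) else 0)"
    unfolding fps_sum_nth using False by (intro sum.cong) (auto simp: geometric_fps_def)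
  also have "\<dots> = (\<Sum>n | n < N \<and> m * Suc n dvd k. of_nat (m * Suc n))"
    by (rule sum.inter_filter[symmetric, of "{..<N}", simplified])
  also have "\<dots> = of_nat m * (if m dvd k then \<Sum>d | d dvd (k div m). of_nat d else 0)"
  proof (cases "m dvd k")
    case True
    then obtain c where c: "k = m * c" by blast
    have c_pos: "c > 0" using False c by simp
    have "c \<le> k" using m c by simp
    have "(\<Sum>n | n < N \<and> m * Suc n dvd k. of_nat (m * Suc n)) = (\<Sum>d | d dvd c. of_nat (m * d) :: complex)"
    proof (rule sum.reindex_bij_witness[where i = "\<lambda>d. d - 1" and j = Suc], goal_cases)
      case (3 d)
      thus ?case using c_pos by (cases d) auto
    next
      case (4 d)
      have "d > 0" "d \<le> N" using 4 c_pos \<open>c \<le> k\<close> k dvd_imp_le[of d c] by (auto intro: dvd_pos_nat)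
      thus ?case using 4 by (cases d) (auto simp: c simp flip: mult_Suc_right)
    qed (use m in \<open>auto simp: c simp flip: mult_Suc_right\<close>)
    thus ?thesis using m by (simp add: c sum_distrib_left)
  next
    case False
    thus ?thesis by (auto intro!: sum.neutral dest: dvd_mult_left)
  qed
  finally show ?thesis
    by (simp add: sigma_fps_def fps_of_nat[symmetric])
qed

text \<open>The logarithmic derivative of the product. Each coefficient of the logarithmic derivatives of the
partial products is eventually constant, so the identity passes to the limit.\<close>

lemma XD_euler_fps:
  assumes m: "m > 0"
  shows "fps_XD (euler_fps m) = - of_nat m * sigma_fps m * euler_fps m"
proof (rule fps_ext)
  fix k
  have "(\<lambda>N. of_nat k * fps_nth (euler_partial m N) k) \<longlonglongrightarrow> of_nat k * fps_nth (euler_fps m) k"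
    by (intro tendsto_intros euler_partial_tendsto m)
  moreover have "\<forall>\<^sub>F N in sequentially. of_nat k * fps_nth (euler_partial m N) k =
      - (\<Sum>i\<le>k. fps_nth (euler_partial m N) i * fps_nth (of_nat m * sigma_fps m) (k - i))"
    using eventually_ge_at_top[of k]
  proof eventually_elim
    case (elim N)
    have "of_nat k * fps_nth (euler_partial m N) k = fps_nth (fps_XD (euler_partial m N)) k"
      by simp
    also have "\<dots> = - (\<Sum>i\<le>k. fps_nth (euler_partial m N) i * fps_nth (\<Sum>n<N. geometric_fps (m * Suc n)) (k - i))"
      unfolding XD_euler_partial[OF m] by (simp add: fps_mult_nth atLeast0AtMost)
    also have "\<dots> = - (\<Sum>i\<le>k. fps_nth (euler_partial m N) i * fps_nth (of_nat m * sigma_fps m) (k - i))"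
      using elim by (intro arg_cong[where f = uminus] sum.cong refl arg_cong2[where f = "(*)"] geometric_sum_nth m) auto
    finally show ?case .
  qed
  ultimately have "(\<lambda>N. - (\<Sum>i\<le>k. fps_nth (euler_partial m N) i * fps_nth (of_nat m * sigma_fps m) (k - i)))
      \<longlonglongrightarrow> of_nat k * fps_nth (euler_fps m) k"
    by (rule Lim_transform_eventually)
  moreover have "(\<lambda>N. - (\<Sum>i\<le>k. fps_nth (euler_partial m N) i * fps_nth (of_nat m * sigma_fps m) (k - i)))
      \<longlonglongrightarrow> - (\<Sum>i\<le>k. fps_nth (euler_fps m) i * fps_nth (of_nat m * sigma_fps m) (k - i))"
    by (intro tendsto_intros euler_partial_tendsto m)
  ultimately have "of_nat k * fps_nth (euler_fps m) k =
      - (\<Sum>i\<le>k. fps_nth (euler_fps m) i * fps_nth (of_nat m * sigma_fps m) (k - i))"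
    by (rule LIMSEQ_unique)
  also have "\<dots> = fps_nth (- (euler_fps m * (of_nat m * sigma_fps m))) k"
    by (simp add: fps_mult_nth atLeast0AtMost)
  finally show "fps_nth (fps_XD (euler_fps m)) k = fps_nth (- of_nat m * sigma_fps m * euler_fps m) k"
    by (simp add: mult_ac)
qed

lemma euler_fps_nth_0: "m > 0 \<Longrightarrow> fps_nth (euler_fps m) 0 = 1"
proof -
  assume m: "m > 0"
  have "fps_nth (euler_partial m N) 0 = 1" for N
    using m by (induction N) (auto simp: euler_partial_def)
  thus ?thesis
    using euler_partial_tendsto[OF m, of 0] LIMSEQ_unique tendsto_const by (metis (no_types, lifting) ext)
qed

lemma sigma_fps_nth_0 [simp]: "fps_nth (sigma_fps m) 0 = 0"
  by (simp add: sigma_fps_def)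

lemma at0_eis2: "12 * at0 eis2 = 1 - 24 * sigma_fps 1"
proof (rule fps_ext)
  fix n show "fps_nth (12 * at0 eis2) n = fps_nth (1 - 24 * sigma_fps 1) n"
    unfolding eis2_def at0_lambert
    by (cases "n = 0") (simp_all add: sigma_fps_def sum_distrib_left sum_negf flip: fps_of_nat)
qed

text \<open>For \<open>m = 2, 3\<close> the terms of an even function at a point of order \<open>m\<close> depend on \<open>d\<close> only through its
size and its divisibility by \<open>m\<close>. This turns the coefficients into divisor sums at \<open>n\<close> and at \<open>n\<close> divided by \<open>m\<close>.\<close>

lemma sum_multiples_of:
  assumes "n > 0" "m > 0"
  shows "(\<Sum>d | d dvd n. if m dvd d then of_nat d else 0) = of_nat m * fps_nth (sigma_fps m) n"
proof -
  have "(\<Sum>d | d dvd n. if m dvd d then of_nat d else 0) = (\<Sum>d | d dvd n \<and> m dvd d. of_nat d :: complex)"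
    using assms by (intro sum.inter_filter[symmetric, of "{d. d dvd n}", simplified]) auto
  also have "\<dots> = of_nat m * (if m dvd n then \<Sum>d | d dvd (n div m). of_nat d else 0)"
  proof (cases "m dvd n")
    case True
    then obtain c where c: "n = m * c" by blast
    have "(\<Sum>d | d dvd n \<and> m dvd d. of_nat d :: complex) = (\<Sum>d | d dvd c. of_nat (m * d))"
      using assms by (intro sum.reindex_bij_witness[where i = "\<lambda>d. m * d" and j = "\<lambda>d. d div m"]) (auto simp: c)
    thus ?thesis using assms by (simp add: c sum_distrib_left)
  next
    case False
    thus ?thesis by (auto intro!: sum.neutral intro: dvd_trans)
  qed
  finally show ?thesis by (simp add: sigma_fps_def)
qed

lemma sigma_fps_1_nth: "fps_nth (sigma_fps 1) n = (\<Sum>d | d dvd n. of_nat d)"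
  by (simp add: sigma_fps_def)

text \<open>The nome takes every value in the punctured unit disc, so an expansion valid on the upper half plane
is the Taylor expansion at 0 of the function of the nome.\<close>

lemma q_expansion_nth:
  assumes "has_q_expansion f a" "\<And>z. f z = g (nome z)" "g has_fps_expansion F" "a 0 = 0" "g 0 = 0"
  shows "fps_nth F n = of_int (a n)"
proof -
  have sums: "(\<lambda>n. of_int (a n) * q ^ n) sums g q" if "norm q < 1" for q
  proof (cases "q = 0")
    case True
    have "(\<lambda>n. of_int (a n) * 0 ^ n) sums (of_int (a 0) :: complex)"
      by (rule powser_sums_zero)
    thus ?thesis using True assms by simp
  next
    case False
    then obtain z where "Im z > 0" "nome z = q"
      using nome_surj[of q] \<open>norm q < 1\<close> by metis
    thus ?thesis
      using assms(1,2) unfolding has_q_expansion_def by metis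
  qed
  have "g has_fps_expansion Abs_fps (\<lambda>n. of_int (a n))"
  proof (rule has_fps_expansionI)
    have "\<forall>\<^sub>F q in nhds (0::complex). q \<in> ball 0 1"
      by (rule eventually_nhds_in_open) auto
    thus "\<forall>\<^sub>F q in nhds 0. (\<lambda>n. fps_nth (Abs_fps (\<lambda>n. of_int (a n))) n * q ^ n) sums g q"
      by eventually_elim (simp add: sums)
  qed
  hence "Abs_fps (\<lambda>n. of_int (a n)) = F"
    using assms(3) by (rule fps_expansion_unique_complex)
  thus ?thesis by auto
qed

definition int_fps :: "complex fps \<Rightarrow> bool" where
  "int_fps F \<longleftrightarrow> (\<forall>n. fps_nth F n \<in> \<int>)"

lemma int_fps_mult: "int_fps F \<Longrightarrow> int_fps G \<Longrightarrow> int_fps (F * G)"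
  by (auto simp: int_fps_def fps_mult_nth intro!: Ints_sum Ints_mult)

section \<open>Level 2: the point of order two\<close>

definition delta2_fps :: "complex fps" where
  "delta2_fps = fps_X * (euler_fps 1 ^ 8 * euler_fps 2 ^ 8)"

lemma delta2_fps_nth: "fps_nth delta2_fps n = of_int (tau_8_2 n)"
proof (rule q_expansion_nth[OF has_q_expansion_tau_8_2 Delta_8_2_nome _ tau_8_2_0])
  show "(\<lambda>q. q * (euler_prod 1 q ^ 8 * euler_prod 2 q ^ 8)) has_fps_expansion delta2_fps"
    unfolding delta2_fps_def by (intro fps_expansion_intros euler_fps_expansion) auto
qed simp

lemma XD_delta2: "fps_XD delta2_fps = (1 - 8 * sigma_fps 1 - 16 * sigma_fps 2) * delta2_fps"
proof -
  have "fps_XD delta2_fps = (1 + (of_nat 8 * (- of_nat 1 * sigma_fps 1) + of_nat 8 * (- of_nat 2 * sigma_fps 2))) * delta2_fps"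
    unfolding delta2_fps_def
    by (intro logderiv_mult logderiv_power XD_fps_X XD_euler_fps) auto
  thus ?thesis by simp
qed

definition wp_half :: "complex fps" where
  "wp_half = at0 (wp (-1) 0)"

definition wp2_half :: "complex fps" where
  "wp2_half = at0 (wp (-1) 2)"

definition weier_half :: "complex fps" where
  "weier_half = wp_half + at0 eis2"

text \<open>Sixteen times the eta quotient $\eta(2z)^{16}/\eta(z)^8$, as \<open>XD_eta_quot_half\<close> reflects. Likewise
\<open>8 * wp2_half\<close> is $\eta(z)^{16}/\eta(2z)^8$, and the product of these two quotients is the cusp form.\<close>

definition eta_quot_half :: "complex fps" where
  "eta_quot_half = 9 * weier_half ^ 2 - 2 * wp2_half"

text \<open>The point $\zeta = -1$ is fixed by $\zeta \mapsto 1/\zeta$, so the odd functions vanish there.\<close>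

lemma zeta_half: "at0 (zeta_series (-1)) = 0"
proof (rule fps_ext)
  fix n show "fps_nth (at0 (zeta_series (-1))) n = fps_nth 0 n"
    by (cases "n = 0") (simp_all add: at0_zeta_nth at0_zeta_nth_0 del: at0_nth)
qed

lemma wp1_half: "at0 (wp (-1) 1) = 0"
proof (rule fps_ext)
  fix n show "fps_nth (at0 (wp (-1) 1)) n = fps_nth 0 n"
    using at0_wp_1_nth_0[of "-1"]
    by (cases "n = 0") (simp_all add: at0_wp_nth zeta_half del: at0_nth)
qed

lemma wp_half_sigma: "4 * wp_half = - 1 - 8 * sigma_fps 1 + 32 * sigma_fps 2"
proof (rule fps_ext)
  fix n
  show "fps_nth (4 * wp_half) n = fps_nth (- 1 - 8 * sigma_fps 1 + 32 * sigma_fps 2) n"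
  proof (cases "n = 0")
    case True
    thus ?thesis
      by (simp add: wp_half_def at0_wp_0_nth_0 zeta_half del: at0_nth)
  next
    case False
    hence "fps_nth wp_half n = (\<Sum>d | d dvd n. of_nat d * (2 * (- 1) ^ d))"
      by (simp add: wp_half_def at0_wp_nth del: at0_nth)
    also have "\<dots> = (\<Sum>d | d dvd n. 4 * (if 2 dvd d then of_nat d else 0) - 2 * of_nat d)"
      by (intro sum.cong) auto
    also have "\<dots> = 8 * fps_nth (sigma_fps 2) n - 2 * fps_nth (sigma_fps 1) n"
      using False sum_multiples_of[of n 2]
      by (simp only: sum_subtractf sum_distrib_left[symmetric] sigma_fps_1_nth) simp
    finally show ?thesis using False by simp
  qed
qed

lemma XD_weier_half: "3 * fps_XD weier_half = 2 * wp2_half - 6 * weier_half * wp_half"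
  using arg_cong[OF XD_weierstrass[of "-1"], of at0] by (simp add: weier_half_def wp2_half_def wp_half_def zeta_half)

lemma wp4_half: "at0 (wp (-1) 4) = 12 * weier_half * wp2_half"
  using arg_cong[OF wp_4[of "-1"], of at0] wp1_half by (simp add: weier_half_def wp2_half_def wp_half_def)

lemma XD_wp2_half: "fps_XD wp2_half = wp2_half * (6 * weier_half - 4 * wp_half)"
proof -
  have "2 * fps_XD wp2_half = 12 * weier_half * wp2_half - 8 * wp_half * wp2_half"
    using arg_cong[OF heat_wp_2[of "-1"], of at0] wp1_half by (simp add: wp2_half_def wp_half_def zeta_half wp4_half)
  hence "2 * fps_XD wp2_half = 2 * (wp2_half * (6 * weier_half - 4 * wp_half))" by Groebner_Basis.algebra
  thus ?thesis by (subst (asm) mult_cancel_left) simp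
qed

lemma XD_eta_quot_half: "fps_XD eta_quot_half = - 4 * wp_half * eta_quot_half"
proof -
  have "fps_XD eta_quot_half = 6 * weier_half * (3 * fps_XD weier_half) - 2 * fps_XD wp2_half"
    by (simp add: eta_quot_half_def power2_eq_square fps_XD_mult fps_XD_diff algebra_simps)
  thus ?thesis
    unfolding XD_weier_half XD_wp2_half eta_quot_half_def by Groebner_Basis.algebra
qed

lemma XD_half_product: "fps_XD (wp2_half * eta_quot_half) = (1 - 8 * sigma_fps 1 - 16 * sigma_fps 2) * (wp2_half * eta_quot_half)"
proof -
  have "2 * (6 * weier_half - 8 * wp_half) = 2 * (1 - 8 * sigma_fps 1 - 16 * sigma_fps 2)"
    unfolding weier_half_def using wp_half_sigma at0_eis2 by Groebner_Basis.algebra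
  hence L: "6 * weier_half - 8 * wp_half = 1 - 8 * sigma_fps 1 - 16 * sigma_fps 2"
    by (subst (asm) mult_cancel_left) simp
  show ?thesis
    unfolding L[symmetric] fps_XD_mult XD_wp2_half XD_eta_quot_half by Groebner_Basis.algebra
qed

lemma wp_half_nth: "fps_nth wp_half 0 = - 1 / 4" "fps_nth wp_half 1 = - 2"
  by (simp_all add: wp_half_def at0_wp_0_nth_0 at0_wp_nth zeta_half del: at0_nth)

lemma eis2_nth: "fps_nth (at0 eis2) 0 = 1 / 12" "fps_nth (at0 eis2) 1 = - 2"
  by (simp_all add: eis2_def)

lemma wp2_half_nth: "fps_nth wp2_half 0 = 1 / 8" "fps_nth wp2_half 1 = - 2"
  using wp_half_nth by (simp_all add: wp2_half_def at0_wp_2_nth_0 at0_wp_nth wp_half_def[symmetric] power2_eq_square del: at0_nth)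

text \<open>Both sides start with $2q$ and have the same logarithmic derivative.\<close>

lemma half_product_delta: "wp2_half * eta_quot_half = 2 * delta2_fps"
proof (rule logderiv_unique[where k = 1])
  show "fps_XD (2 * delta2_fps) = (1 - 8 * sigma_fps 1 - 16 * sigma_fps 2) * (2 * delta2_fps)"
    by (simp add: fps_XD_mult XD_delta2)
  have weier_half: "fps_nth weier_half 0 = - 1 / 6" "fps_nth weier_half 1 = - 4"
    by (simp_all add: weier_half_def wp_half_nth eis2_nth del: at0_nth One_nat_def)
  have eta_quot_half: "fps_nth eta_quot_half 0 = 0" "fps_nth eta_quot_half 1 = 16"
    by (simp_all add: eta_quot_half_def fps_nth_power_0 fps_square_nth_1 weier_half wp2_half_nth power_divide del: One_nat_def)
  have "fps_nth delta2_fps 1 = 1"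
    by (simp add: delta2_fps_def euler_fps_nth_0 fps_nth_power_0)
  thus "fps_nth (wp2_half * eta_quot_half) 1 = fps_nth (2 * delta2_fps) 1"
    by (simp add: fps_mult_nth_1 eta_quot_half wp2_half_nth del: One_nat_def)
qed (use XD_half_product in simp_all)

text \<open>The factor 17 arises from $144\,e^2 x + 36 x^2 = 16\,(9e^2 - 2x)\,x + 68\,x^2$, where $e$ and $x$ are the
values of $\wp$ and its second derivative, and $68 = 4 \cdot 17$. The factor 16 makes the remainder
integral.\<close>

lemma level2_identity:
  "\<exists>G. int_fps G \<and> 16 * at0 (wp (-1) 6) = 512 * delta2_fps + 17 * G"
proof (intro exI conjI)
  have "fps_nth (8 * wp2_half) n \<in> \<int>" for n
  proof (cases "n = 0")
    case False
    hence "fps_nth (8 * wp2_half) n = (\<Sum>d | d dvd n. 16 * (of_nat d ^ 3 * (- 1) ^ d))"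
      by (simp add: wp2_half_def at0_wp_nth sum_distrib_left mult_ac numeral_3_eq_3 del: at0_nth)
    thus ?thesis by (auto intro!: Ints_sum Ints_mult Ints_power)
  qed (simp add: wp2_half_nth)
  hence int: "int_fps (8 * wp2_half)" by (simp add: int_fps_def)
  show "int_fps (8 * wp2_half * (8 * wp2_half))" by (rule int_fps_mult[OF int int])
  have "at0 (wp (-1) 6) = 12 * weier_half * (12 * weier_half * wp2_half) + 36 * wp2_half ^ 2"
    using arg_cong[OF wp_6[of "-1"], of at0] wp1_half by (simp add: wp4_half weier_half_def wp2_half_def wp_half_def)
  thus "16 * at0 (wp (-1) 6) = 512 * delta2_fps + 17 * (8 * wp2_half * (8 * wp2_half))"
    using half_product_delta unfolding eta_quot_half_def by Groebner_Basis.algebra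
qed

text \<open>For odd \<open>n\<close> all divisors \<open>d\<close> are odd and $(-1)^d + (-1)^{-d} = -2$. Modulo 17 the resulting relation
$-32\,\sigma_7(n) = 512\,\tau(n)$ is $2\,\sigma_7(n) = 2\,\tau(n)$,
and the constant 9 in the proof is the inverse of 2.\<close>

lemma tau_8_2_cong:
  assumes "odd n"
  shows "[tau_8_2 n = int (divisor_sum 7 n)] (mod 17)"
proof -
  have n: "n > 0" using assms by (auto intro!: Nat.gr0I)
  obtain G where G: "int_fps G" "16 * at0 (wp (-1) 6) = 512 * delta2_fps + 17 * G"
    using level2_identity by blast
  obtain g where g: "fps_nth G n = of_int g"
    using G(1) by (auto simp: int_fps_def elim!: Ints_cases)
  have "fps_nth (at0 (wp (-1) 6)) n = (\<Sum>d | d dvd n. - (2 * of_nat d ^ 7))"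
    unfolding at0_wp_nth[OF n]
  proof (rule sum.cong, goal_cases)
    case (2 d)
    hence "odd d" using assms by (auto intro: dvd_trans)
    thus ?case by simp
  qed simp
  also have "\<dots> = of_int (- 2 * int (divisor_sum 7 n))"
    by (simp add: divisor_sum_def sum_distrib_left sum_negf)
  finally have "of_int (16 * (- 2 * int (divisor_sum 7 n))) = (of_int (512 * tau_8_2 n + 17 * g) :: complex)"
    using arg_cong[OF G(2), of "\<lambda>F. fps_nth F n"] g by (simp add: delta2_fps_nth del: at0_nth)
  hence "16 * (- 2 * int (divisor_sum 7 n)) = 512 * tau_8_2 n + 17 * g"
    by (simp only: of_int_eq_iff)
  hence "tau_8_2 n - int (divisor_sum 7 n) =
         17 * (9 * (- g - 30 * tau_8_2 n - 2 * int (divisor_sum 7 n)) - (tau_8_2 n - int (divisor_sum 7 n)))"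
    by (simp add: algebra_simps)
  thus ?thesis
    unfolding cong_iff_dvd_diff by (rule dvdI)
qed

section \<open>The substitution of the cube of q\<close>

definition cubic_subst :: "complex fps \<Rightarrow> complex fps" where
  "cubic_subst F = F oo fps_X ^ 3"

lemma cubic_subst_nth: "fps_nth (cubic_subst F) n = (if 3 dvd n then fps_nth F (n div 3) else 0)"
proof -
  have "fps_nth (cubic_subst F) n = (\<Sum>i=0..n. fps_nth F i * (if n = 3 * i then 1 else 0))"
    by (simp add: cubic_subst_def fps_compose_nth fps_X_power_nth flip: power_mult)
  also have "\<dots> = (if 3 dvd n then fps_nth F (n div 3) else 0)"
  proof (cases "3 dvd n")
    case True
    then obtain c where "n = 3 * c" by blast
    thus ?thesis by (simp add: sum.delta if_distrib[of "\<lambda>x. _ * x"] cong: if_cong)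
  next
    case False
    hence "n \<noteq> 3 * i" for i by auto
    thus ?thesis using False by simp
  qed
  finally show ?thesis .
qed

lemma cubic_subst_add: "cubic_subst (F + G) = cubic_subst F + cubic_subst G"
  by (simp add: cubic_subst_def fps_compose_add_distrib)

lemma cubic_subst_diff: "cubic_subst (F - G) = cubic_subst F - cubic_subst G"
  by (simp add: cubic_subst_def fps_compose_sub_distrib)

lemma cubic_subst_uminus: "cubic_subst (- F) = - cubic_subst F"
  by (simp add: cubic_subst_def fps_compose_uminus)

lemma cubic_subst_mult: "cubic_subst (F * G) = cubic_subst F * cubic_subst G"
  unfolding cubic_subst_def by (rule fps_compose_mult_distrib) simp

lemma cubic_subst_1: "cubic_subst 1 = 1"
  by (simp add: cubic_subst_def)

lemma cubic_subst_numeral: "cubic_subst (numeral k) = numeral k"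
  by (simp add: cubic_subst_def)

lemma cubic_subst_power: "cubic_subst (F ^ n) = cubic_subst F ^ n"
  by (induction n) (simp_all add: cubic_subst_1 cubic_subst_mult)

lemma cubic_subst_fps_X: "cubic_subst fps_X = fps_X ^ 3"
  by (simp add: cubic_subst_def)

lemmas cubic_subst_hom = cubic_subst_add cubic_subst_diff cubic_subst_uminus cubic_subst_mult
  cubic_subst_1 cubic_subst_numeral cubic_subst_power cubic_subst_fps_X

lemma XD_cubic_subst: "fps_XD (cubic_subst F) = 3 * cubic_subst (fps_XD F)"
  by (rule fps_ext) (auto simp: cubic_subst_nth elim!: dvdE)

lemma cubic_subst_sigma: "cubic_subst (sigma_fps m) = sigma_fps (3 * m)"
proof (rule fps_ext)
  fix n
  show "fps_nth (cubic_subst (sigma_fps m)) n = fps_nth (sigma_fps (3 * m)) n"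
  proof (cases "3 dvd n")
    case True
    thus ?thesis by (auto simp: cubic_subst_nth sigma_fps_def elim!: dvdE)
  next
    case False
    thus ?thesis by (auto simp: cubic_subst_nth sigma_fps_def dest: dvd_mult_left)
  qed
qed

lemma cubic_subst_euler:
  assumes "m > 0"
  shows "cubic_subst (euler_fps m) = euler_fps (3 * m)"
proof (rule logderiv_unique[where k = 0 and L = "- of_nat (3 * m) * sigma_fps (3 * m)"])
  have "cubic_subst (of_nat m :: complex fps) = of_nat m"
    by (simp add: cubic_subst_def flip: fps_of_nat)
  thus "fps_XD (cubic_subst (euler_fps m)) = - of_nat (3 * m) * sigma_fps (3 * m) * cubic_subst (euler_fps m)"
    unfolding XD_cubic_subst XD_euler_fps[OF assms] cubic_subst_hom cubic_subst_sigma
    by (simp add: mult_ac)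
qed (use assms in \<open>simp_all add: XD_euler_fps cubic_subst_nth euler_fps_nth_0\<close>)

text \<open>Comparing coefficients at \<open>n\<close>, with all lower ones zero, gives $12(n-1)U_n = 0$ and then
$(4n+2)V_n = 0$: the only free coefficient is that of \<open>U\<close> at \<open>n = 1\<close>.\<close>

lemma linear_system_unique:
  fixes U V :: "complex fps"
  assumes U: "12 * fps_XD U = A * U + B * V" and V: "4 * fps_XD V = C * U + D * V"
    and "fps_nth A 0 = 12" "fps_nth B 0 = 0" "fps_nth D 0 = - 2" "fps_nth U 1 = 0"
  shows "U = 0"
proof -
  have "fps_nth U n = 0 \<and> fps_nth V n = 0" for n
  proof (induction n rule: less_induct)
    case (less n)
    have lin: "fps_nth (F * U + G * V) n = fps_nth F 0 * fps_nth U n + fps_nth G 0 * fps_nth V n" for F G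
    proof -
      have "fps_nth (F * H) n = fps_nth F 0 * fps_nth H n" if "\<And>m. m < n \<Longrightarrow> fps_nth H m = 0" for H
      proof -
        have "fps_nth (F * H) n = (\<Sum>i\<in>{0}. fps_nth F i * fps_nth H (n - i))"
          unfolding fps_mult_nth using that by (intro sum.mono_neutral_right) auto
        thus ?thesis by simp
      qed
      moreover have "fps_nth (G * H) n = fps_nth G 0 * fps_nth H n" if "\<And>m. m < n \<Longrightarrow> fps_nth H m = 0" for H
      proof -
        have "fps_nth (G * H) n = (\<Sum>i\<in>{0}. fps_nth G i * fps_nth H (n - i))"
          unfolding fps_mult_nth using that by (intro sum.mono_neutral_right) auto
        thus ?thesis by simp
      qed
      ultimately show ?thesis using less.IH by simp
    qed
    have "fps_nth (12 * fps_XD U) n = fps_nth (A * U + B * V) n"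
      by (simp only: U)
    hence "12 * (of_nat n * fps_nth U n) = 12 * fps_nth U n"
      unfolding lin by (simp add: assms(3-5))
    hence "(of_nat n - 1) * fps_nth U n = 0"
      by (simp add: algebra_simps)
    hence Un: "fps_nth U n = 0"
      using assms(6) by (cases "n = 1") auto
    have "fps_nth (4 * fps_XD V) n = fps_nth (C * U + D * V) n"
      by (simp only: V)
    hence "4 * (of_nat n * fps_nth V n) = - 2 * fps_nth V n"
      unfolding lin by (simp add: assms(3-5) Un)
    hence "of_nat (4 * n + 2) * fps_nth V n = 0"
      unfolding of_nat_add of_nat_mult of_nat_numeral by Groebner_Basis.algebra
    moreover have "of_nat (4 * n + 2) \<noteq> (0 :: complex)"
      by (simp only: of_nat_eq_0_iff)
    ultimately have "fps_nth V n = 0"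
      by (simp only: mult_eq_0_iff simp_thms)
    thus ?case using Un by simp
  qed
  thus ?thesis by (simp add: fps_eq_iff)
qed

section \<open>Level 3: the points of order three\<close>

definition delta3_fps :: "complex fps" where
  "delta3_fps = fps_X * (euler_fps 1 ^ 12 * euler_fps 3 ^ 4
     + 18 * fps_X * euler_fps 1 ^ 9 * euler_fps 3 ^ 4 * euler_fps 9 ^ 3
     + 81 * fps_X ^ 2 * euler_fps 1 ^ 6 * euler_fps 3 ^ 4 * euler_fps 9 ^ 6)"

lemma delta3_fps_nth: "fps_nth delta3_fps n = of_int (tau_8_3 n)"
proof (rule q_expansion_nth[OF has_q_expansion_tau_8_3 Delta_8_3_nome _ tau_8_3_0])
  show "(\<lambda>q. q * (euler_prod 1 q ^ 12 * euler_prod 3 q ^ 4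
      + 18 * q * euler_prod 1 q ^ 9 * euler_prod 3 q ^ 4 * euler_prod 9 q ^ 3
      + 81 * q ^ 2 * euler_prod 1 q ^ 6 * euler_prod 3 q ^ 4 * euler_prod 9 q ^ 6)) has_fps_expansion delta3_fps"
    unfolding delta3_fps_def by (intro fps_expansion_intros euler_fps_expansion) auto
qed simp

definition omega :: complex where
  "omega = Complex (- 1 / 2) (sqrt 3 / 2)"

lemma omega: "omega ^ 2 + omega + 1 = 0"
  by (simp add: omega_def power2_eq_square complex_eq_iff)

lemma omega_neq: "omega \<noteq> 0" "omega \<noteq> 1"
  by (auto simp: omega_def complex_eq_iff)

definition sqrt_m3 :: complex where
  "sqrt_m3 = 1 + 2 * omega"

lemma sqrt_m3_square: "sqrt_m3 ^ 2 = - 3"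
  unfolding sqrt_m3_def using omega by Groebner_Basis.algebra

definition chi3 :: "nat \<Rightarrow> int" where
  "chi3 d = (if d mod 3 = 1 then 1 else if d mod 3 = 2 then - 1 else 0)"

lemma inverse_omega: "inverse omega = - 1 - omega"
proof -
  have "omega * (- 1 - omega) = 1"
    using omega by Groebner_Basis.algebra
  thus ?thesis by (rule inverse_unique)
qed

text \<open>At $\zeta = \omega$ the even functions see only whether 3 divides \<open>d\<close>, and the odd functions see the
quadratic character modulo 3, with a factor $\sqrt{-3}$.\<close>

lemma omega_power:
  "omega ^ d + inverse omega ^ d = (if 3 dvd d then 2 else - 1)"
  "omega ^ d - inverse omega ^ d = sqrt_m3 * of_int (chi3 d)"
proof -
  have o3: "omega ^ 3 = 1" "inverse omega ^ 3 = 1"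
    unfolding inverse_omega using omega by Groebner_Basis.algebra+
  have red: "omega ^ d = omega ^ (d mod 3)" "inverse omega ^ d = inverse omega ^ (d mod 3)"
    using o3 by (metis mod_mult_div_eq mult_1 power_add power_mult power_one mult.right_neutral)+
  have sq: "omega ^ 2 = - 1 - omega" "(- 1 - omega) ^ 2 = omega"
    using omega by Groebner_Basis.algebra+
  consider "d mod 3 = 0" | "d mod 3 = 1" | "d mod 3 = 2" by arith
  hence "omega ^ d + inverse omega ^ d = (if 3 dvd d then 2 else - 1) \<and>
    omega ^ d - inverse omega ^ d = sqrt_m3 * of_int (chi3 d)"
  proof cases
    case 1
    hence "omega ^ d = 1" "inverse omega ^ d = 1" using red by simp_all
    with 1 show ?thesis by (simp add: chi3_def dvd_eq_mod_eq_0)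
  next
    case 2
    hence "omega ^ d = omega" "inverse omega ^ d = - 1 - omega" using red inverse_omega by simp_all
    with 2 show ?thesis by (simp add: chi3_def dvd_eq_mod_eq_0 sqrt_m3_def)
  next
    case 3
    hence "omega ^ d = - 1 - omega" "inverse omega ^ d = omega" using red inverse_omega sq by simp_all
    with 3 show ?thesis by (simp add: chi3_def dvd_eq_mod_eq_0 sqrt_m3_def)
  qed
  thus "omega ^ d + inverse omega ^ d = (if 3 dvd d then 2 else - 1)"
    "omega ^ d - inverse omega ^ d = sqrt_m3 * of_int (chi3 d)"
    by blast+
qed

definition zeta_third :: "complex fps" where
  "zeta_third = at0 (zeta_series omega)"

definition wp_third :: "complex fps" where
  "wp_third = at0 (wp omega 0)"

definition wp1_third :: "complex fps" where
  "wp1_third = at0 (wp omega 1)"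

text \<open>The cubic theta function $a(q) = \sum_{m,n} q^{m^2+mn+n^2}$, in its Lambert series form.\<close>

definition cubic_a :: "complex fps" where
  "cubic_a = lambert 1 (\<lambda>d. 6 * of_int (chi3 d))"

text \<open>The cube of the cubic theta function $b(q)$, that is $\eta(z)^9/\eta(3z)^3$; see \<open>cubic_b3_euler\<close>.\<close>

definition cubic_b3 :: "complex fps" where
  "cubic_b3 = lambert 1 (\<lambda>d. - 9 * of_int (chi3 d) * of_nat d ^ 2)"

text \<open>The cube of the cubic theta function $c(q)$, that is $27\,\eta(3z)^9/\eta(z)^3$; see
\<open>cubic_c3_euler\<close>. Taking $a^3 = b^3 + c^3$ as the definition is convenient because the derivative
of this difference is computable from those of $a$ and $b^3$.\<close>

definition cubic_c3 :: "complex fps" where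
  "cubic_c3 = cubic_a ^ 3 - cubic_b3"

definition sqrt_m3_fps :: "complex fps" where
  "sqrt_m3_fps = fps_const sqrt_m3"

lemma sqrt_m3_fps_square: "sqrt_m3_fps ^ 2 = - 3"
proof -
  have "sqrt_m3_fps ^ 2 = fps_const (sqrt_m3 ^ 2)"
    by (simp add: sqrt_m3_fps_def power2_eq_square)
  thus ?thesis by (simp add: sqrt_m3_square neg_numeral_fps_const)
qed

lemma zeta_third_nth_0: "fps_nth zeta_third 0 = sqrt_m3 / 6"
proof -
  have "(1 + omega) * 6 = 2 * (1 - omega) * sqrt_m3"
    unfolding sqrt_m3_def using omega by Groebner_Basis.algebra
  thus ?thesis
    using omega_neq by (simp add: zeta_third_def at0_zeta_nth_0 field_simps del: at0_nth)
qed

lemma wp_third_nth_0: "fps_nth wp_third 0 = - 1 / 3"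
  unfolding wp_third_def
  by (simp add: at0_wp_0_nth_0 omega_neq zeta_third_def[symmetric] zeta_third_nth_0 power_divide sqrt_m3_square del: at0_nth)

lemma wp1_third_nth_0: "fps_nth wp1_third 0 = - sqrt_m3 / 9"
  unfolding wp1_third_def
  by (simp add: at0_wp_1_nth_0 omega_neq zeta_third_def[symmetric] wp_third_def[symmetric] zeta_third_nth_0 wp_third_nth_0 del: at0_nth One_nat_def)

lemma zeta_third_cubic_a: "6 * zeta_third = sqrt_m3_fps * cubic_a"
proof (rule fps_ext)
  fix n show "fps_nth (6 * zeta_third) n = fps_nth (sqrt_m3_fps * cubic_a) n"
  proof (cases "n = 0")
    case False
    hence "fps_nth zeta_third n = (\<Sum>d | d dvd n. sqrt_m3 * of_int (chi3 d))"
      by (simp add: zeta_third_def at0_zeta_nth omega_power del: at0_nth)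
    thus ?thesis
      using False by (simp add: cubic_a_def sqrt_m3_fps_def sum_distrib_left mult.left_commute)
  qed (simp add: zeta_third_nth_0 cubic_a_def sqrt_m3_fps_def)
qed

lemma wp1_third_cubic_b3: "9 * wp1_third = - sqrt_m3_fps * cubic_b3"
proof (rule fps_ext)
  fix n show "fps_nth (9 * wp1_third) n = fps_nth (- sqrt_m3_fps * cubic_b3) n"
  proof (cases "n = 0")
    case False
    hence "fps_nth wp1_third n = (\<Sum>d | d dvd n. of_nat d ^ 2 * (sqrt_m3 * of_int (chi3 d)))"
      by (simp add: wp1_third_def at0_wp_nth omega_power[symmetric] numeral_2_eq_2 del: at0_nth)
    hence "fps_nth (9 * wp1_third) n = (\<Sum>d | d dvd n. 9 * (of_nat d ^ 2 * (sqrt_m3 * of_int (chi3 d))))"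
      by (simp add: sum_distrib_left)
    also have "\<dots> = (\<Sum>d | d dvd n. - sqrt_m3 * (- 9 * of_int (chi3 d) * of_nat d ^ 2))"
      by (intro sum.cong) auto
    also have "\<dots> = fps_nth (- sqrt_m3_fps * cubic_b3) n"
      using False by (simp add: cubic_b3_def sqrt_m3_fps_def sum_distrib_left)
    finally show ?thesis .
  qed (simp add: wp1_third_nth_0 cubic_b3_def sqrt_m3_fps_def)
qed

lemma wp_third_sigma: "3 * wp_third = - 1 - 3 * sigma_fps 1 + 27 * sigma_fps 3"
proof (rule fps_ext)
  fix n
  show "fps_nth (3 * wp_third) n = fps_nth (- 1 - 3 * sigma_fps 1 + 27 * sigma_fps 3) n"
  proof (cases "n = 0")
    case False
    hence "fps_nth wp_third n = (\<Sum>d | d dvd n. of_nat d * (if 3 dvd d then 2 else - 1))"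
      by (simp add: wp_third_def at0_wp_nth omega_power del: at0_nth)
    also have "\<dots> = (\<Sum>d | d dvd n. 3 * (if 3 dvd d then of_nat d else 0) - of_nat d)"
      by (intro sum.cong) auto
    also have "\<dots> = 9 * fps_nth (sigma_fps 3) n - fps_nth (sigma_fps 1) n"
      using False sum_multiples_of[of n 3]
      by (simp only: sum_subtractf sum_distrib_left[symmetric] sigma_fps_1_nth) simp
    finally show ?thesis using False by simp
  qed (simp add: wp_third_nth_0)
qed

lemma log_theta_third: "at0 (log_theta omega) = 3 * sigma_fps 3"
proof (rule fps_ext)
  fix n
  show "fps_nth (at0 (log_theta omega)) n = fps_nth (3 * sigma_fps 3) n"
  proof (cases "n = 0")
    case False
    have even_0: "fps_nth (twist_even omega (int d)) 0 = (if 3 dvd d then 2 else - 1)" for d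
      using omega_power(1)[of d] by (simp add: twist_even_def twist_nth_0 power_int_minus power_inverse)
    have "fps_nth (at0 (log_theta omega)) n =
          (\<Sum>d | d dvd n. of_nat (n div d) * (if 3 dvd d then 2 else - 1) + of_nat d)"
      by (simp add: log_theta_def fps_sum_nth even_0 flip: fps_of_nat cong: if_cong)
    also have "\<dots> = (\<Sum>d | d dvd n. 3 * (if 3 dvd d then of_nat (n div d) else 0) - of_nat (n div d) + of_nat d)"
      by (intro sum.cong) auto
    also have "\<dots> = 3 * (\<Sum>d | d dvd n. if 3 dvd d then of_nat (n div d) else 0)
        - (\<Sum>d | d dvd n. of_nat (n div d)) + (\<Sum>d | d dvd n. of_nat d)"
      by (simp only: sum.distrib sum_subtractf sum_distrib_left)
    also have "(\<Sum>d | d dvd n. of_nat (n div d)) = (\<Sum>d | d dvd n. of_nat d :: complex)"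
      using False by (intro sum.reindex_bij_witness[where i = "\<lambda>d. n div d" and j = "\<lambda>d. n div d"]) auto
    also have "(\<Sum>d | d dvd n. if 3 dvd d then of_nat (n div d) else 0) = fps_nth (sigma_fps 3) n"
    proof -
      have "(\<Sum>d | d dvd n. if 3 dvd d then of_nat (n div d) else 0 :: complex) =
            (\<Sum>d | d dvd n \<and> 3 dvd d. of_nat (n div d))"
        using False by (intro sum.inter_filter[symmetric, of "{d. d dvd n}", simplified]) auto
      also have "\<dots> = (if 3 dvd n then \<Sum>d | d dvd (n div 3). of_nat d else 0)"
      proof (cases "3 dvd n")
        case True
        then obtain c where c: "n = 3 * c" by blast
        have "(\<Sum>d | d dvd n \<and> 3 dvd d. of_nat (n div d) :: complex) = (\<Sum>d | d dvd c. of_nat d)"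
          using False
          by (intro sum.reindex_bij_witness[where i = "\<lambda>d. n div d" and j = "\<lambda>d. n div d"])
             (auto simp: c elim!: dvdE)
        thus ?thesis by (simp add: c)
      next
        case False
        thus ?thesis by (auto intro!: sum.neutral intro: dvd_trans)
      qed
      finally show ?thesis by (simp add: sigma_fps_def)
    qed
    finally show ?thesis by simp
  qed (simp add: log_theta_def)
qed

lemma zeta_third_square: "4 * zeta_third ^ 2 = 4 * wp_third + 1 - 24 * sigma_fps 3"
  using arg_cong[OF zeta_square[OF omega_neq], of at0]
  by (simp add: zeta_third_def wp_third_def log_theta_third du_zeta_series)

text \<open>At a point of order three $\wp = 3S^2$, where $S$ is the value of the zeta series.
By \<open>zeta_square\<close> this is a relation between divisor-sum series.\<close>

lemma weierstrass_third: "wp_third + at0 eis2 = 3 * zeta_third ^ 2"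
proof -
  have "12 * (wp_third + at0 eis2) = 12 * (3 * zeta_third ^ 2)"
    using zeta_third_square wp_third_sigma at0_eis2 by Groebner_Basis.algebra
  thus ?thesis by (subst (asm) mult_cancel_left) simp
qed

lemma XD_zeta_third: "2 * fps_XD zeta_third = wp1_third - 2 * zeta_third * wp_third"
  using arg_cong[OF heat_zeta[OF omega_neq], of at0] by (simp add: zeta_third_def wp_third_def wp1_third_def)

text \<open>Differentiating $\wp = 3S^2$ with respect to \<open>q\<close> in two ways.\<close>

lemma wp2_third: "at0 (wp omega 2) = 6 * zeta_third * wp1_third"
proof -
  have "3 * fps_XD (wp_third + at0 eis2) = 2 * at0 (wp omega 2) - 6 * (wp_third + at0 eis2) * wp_third - 3 * zeta_third * wp1_third"
    using arg_cong[OF XD_weierstrass[OF omega_neq], of at0] by (simp add: zeta_third_def wp_third_def wp1_third_def)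
  moreover have "fps_XD (3 * zeta_third ^ 2) = 6 * zeta_third * fps_XD zeta_third"
    by (simp add: power2_eq_square fps_XD_mult algebra_simps)
  ultimately have "2 * at0 (wp omega 2) = 2 * (6 * zeta_third * wp1_third)"
    unfolding weierstrass_third using XD_zeta_third by Groebner_Basis.algebra
  thus ?thesis by (subst (asm) mult_cancel_left) simp
qed

lemma wp3_third: "at0 (wp omega 3) = 36 * zeta_third ^ 2 * wp1_third"
proof -
  have "at0 (wp omega 3) = 12 * (wp_third + at0 eis2) * wp1_third"
    unfolding wp_3[OF omega_neq] wp_third_def wp1_third_def by (simp only: at0_mult at0_add at0_numeral)
  thus ?thesis unfolding weierstrass_third by Groebner_Basis.algebra
qed

lemma wp4_third: "at0 (wp omega 4) = 216 * zeta_third ^ 3 * wp1_third + 12 * wp1_third ^ 2"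
proof -
  have "at0 (wp omega 4) = 12 * (wp_third + at0 eis2) * at0 (wp omega 2) + 12 * wp1_third ^ 2"
    unfolding wp_4[OF omega_neq] wp_third_def wp1_third_def by (simp only: at0_mult at0_add at0_numeral at0_power)
  thus ?thesis unfolding weierstrass_third wp2_third by Groebner_Basis.algebra
qed

text \<open>By repeated use of the differential equation, everything is a polynomial in the zeta series and $\wp'$.\<close>

lemma wp6_third: "at0 (wp omega 6) = zeta_third ^ 2 * wp1_third * (7776 * zeta_third ^ 3 + 3456 * wp1_third)"
proof -
  have "at0 (wp omega 6) = 12 * (wp_third + at0 eis2) * at0 (wp omega 4) + 48 * wp1_third * at0 (wp omega 3) + 36 * at0 (wp omega 2) ^ 2"
    unfolding wp_6[OF omega_neq] wp_third_def wp1_third_def by (simp only: at0_mult at0_add at0_numeral at0_power)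
  thus ?thesis unfolding weierstrass_third wp2_third wp3_third wp4_third by Groebner_Basis.algebra
qed

lemma sqrt_m3_fps_nonzero: "sqrt_m3_fps \<noteq> 0"
  using sqrt_m3_fps_square by auto

lemma cancel_sqrt_m3: "sqrt_m3_fps * F = sqrt_m3_fps * G \<Longrightarrow> F = G"
  using sqrt_m3_fps_nonzero by simp

lemma cubic_a_square: "cubic_a ^ 2 = 1 + 12 * sigma_fps 1 - 36 * sigma_fps 3"
proof -
  have "3 * cubic_a ^ 2 = 3 * (1 + 12 * sigma_fps 1 - 36 * sigma_fps 3)"
    using zeta_third_cubic_a sqrt_m3_fps_square zeta_third_square wp_third_sigma by Groebner_Basis.algebra
  thus ?thesis by (subst (asm) mult_cancel_left) simp
qed

lemma XD_cubic_a: "3 * fps_XD cubic_a = - cubic_b3 - 3 * cubic_a * wp_third"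
proof -
  have "6 * fps_XD zeta_third = sqrt_m3_fps * fps_XD cubic_a"
    using arg_cong[OF zeta_third_cubic_a, of fps_XD] by (simp add: fps_XD_mult) (simp add: sqrt_m3_fps_def fps_XD_def)
  hence "sqrt_m3_fps * (3 * fps_XD cubic_a) = sqrt_m3_fps * (- cubic_b3 - 3 * cubic_a * wp_third)"
    using XD_zeta_third wp1_third_cubic_b3 zeta_third_cubic_a by Groebner_Basis.algebra
  thus ?thesis by (rule cancel_sqrt_m3)
qed

lemma XD_cubic_b3: "fps_XD cubic_b3 = (- 9 * sigma_fps 1 + 9 * sigma_fps 3) * cubic_b3"
proof -
  have "2 * fps_XD wp1_third = at0 (wp omega 3) - 6 * wp_third * wp1_third - 2 * zeta_third * at0 (wp omega 2)"
    using arg_cong[OF heat_wp_1[OF omega_neq], of at0] by (simp add: zeta_third_def wp_third_def wp1_third_def)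
  hence "2 * fps_XD wp1_third = 2 * ((- 9 * sigma_fps 1 + 9 * sigma_fps 3) * wp1_third)"
    unfolding wp3_third wp2_third using zeta_third_square wp_third_sigma by Groebner_Basis.algebra
  hence XD_r: "fps_XD wp1_third = (- 9 * sigma_fps 1 + 9 * sigma_fps 3) * wp1_third"
    by (subst (asm) mult_cancel_left) simp
  have "9 * fps_XD wp1_third = - sqrt_m3_fps * fps_XD cubic_b3"
    using arg_cong[OF wp1_third_cubic_b3, of fps_XD] by (simp add: fps_XD_mult) (simp add: sqrt_m3_fps_def fps_XD_def)
  hence "sqrt_m3_fps * fps_XD cubic_b3 = sqrt_m3_fps * ((- 9 * sigma_fps 1 + 9 * sigma_fps 3) * cubic_b3)"
    using XD_r wp1_third_cubic_b3 by Groebner_Basis.algebra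
  thus ?thesis by (rule cancel_sqrt_m3)
qed

lemma XD_cubic_c3: "fps_XD cubic_c3 = (1 + 3 * sigma_fps 1 - 27 * sigma_fps 3) * cubic_c3"
proof -
  have "fps_XD cubic_c3 = cubic_a ^ 2 * (3 * fps_XD cubic_a) - fps_XD cubic_b3"
    by (simp add: cubic_c3_def fps_XD_diff power3_eq_cube power2_eq_square fps_XD_mult algebra_simps)
  thus ?thesis
    unfolding XD_cubic_a XD_cubic_b3 cubic_c3_def using cubic_a_square wp_third_sigma by Groebner_Basis.algebra
qed

lemma cubic_a_nth: "fps_nth cubic_a 0 = 1" "fps_nth cubic_a 1 = 6"
  by (simp_all add: cubic_a_def chi3_def)

lemma cubic_b3_nth: "fps_nth cubic_b3 0 = 1" "fps_nth cubic_b3 1 = - 9"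
  by (simp_all add: cubic_b3_def chi3_def)

lemma cubic_c3_nth: "fps_nth cubic_c3 0 = 0" "fps_nth cubic_c3 1 = 27"
proof -
  have "cubic_a ^ 3 = cubic_a * cubic_a ^ 2"
    by (simp add: power3_eq_cube power2_eq_square)
  thus "fps_nth cubic_c3 0 = 0" "fps_nth cubic_c3 1 = 27"
    by (simp_all add: cubic_c3_def fps_mult_nth_1 fps_square_nth_1 cubic_a_nth cubic_b3_nth fps_nth_power_0 del: One_nat_def)
qed

lemma cubic_b3_c3: "cubic_b3 * cubic_c3 = 27 * (fps_X * (euler_fps 1 ^ 6 * euler_fps 3 ^ 6))"
proof (rule logderiv_unique[where k = 1])
  have "fps_XD (cubic_b3 * cubic_c3) = ((- 9 * sigma_fps 1 + 9 * sigma_fps 3) + (1 + 3 * sigma_fps 1 - 27 * sigma_fps 3)) * (cubic_b3 * cubic_c3)"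
    by (intro logderiv_mult XD_cubic_b3 XD_cubic_c3)
  thus "fps_XD (cubic_b3 * cubic_c3) = (1 - 6 * sigma_fps 1 - 18 * sigma_fps 3) * (cubic_b3 * cubic_c3)"
    by Groebner_Basis.algebra
  have "fps_XD (fps_X * (euler_fps 1 ^ 6 * euler_fps 3 ^ 6)) =
     (1 + (of_nat 6 * (- of_nat 1 * sigma_fps 1) + of_nat 6 * (- of_nat 3 * sigma_fps 3))) *
     (fps_X * (euler_fps 1 ^ 6 * euler_fps 3 ^ 6))"
    by (intro logderiv_mult logderiv_power XD_fps_X XD_euler_fps) auto
  thus "fps_XD (27 * (fps_X * (euler_fps 1 ^ 6 * euler_fps 3 ^ 6))) =
     (1 - 6 * sigma_fps 1 - 18 * sigma_fps 3) * (27 * (fps_X * (euler_fps 1 ^ 6 * euler_fps 3 ^ 6)))"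
    by (simp add: fps_XD_mult[of 27])
  show "fps_nth (cubic_b3 * cubic_c3) 1 = fps_nth (27 * (fps_X * (euler_fps 1 ^ 6 * euler_fps 3 ^ 6))) 1"
    by (simp add: fps_mult_nth_1 cubic_c3_nth cubic_b3_nth fps_nth_power_0 euler_fps_nth_0 del: One_nat_def)
qed simp

lemma cubic_b3_euler: "cubic_b3 * euler_fps 3 ^ 3 = euler_fps 1 ^ 9"
proof (rule logderiv_unique[where k = 0])
  have "fps_XD (cubic_b3 * euler_fps 3 ^ 3) =
     ((- 9 * sigma_fps 1 + 9 * sigma_fps 3) + of_nat 3 * (- of_nat 3 * sigma_fps 3)) * (cubic_b3 * euler_fps 3 ^ 3)"
    by (intro logderiv_mult logderiv_power XD_cubic_b3 XD_euler_fps) auto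
  thus "fps_XD (cubic_b3 * euler_fps 3 ^ 3) = (- 9 * sigma_fps 1) * (cubic_b3 * euler_fps 3 ^ 3)"
    by simp
  have "fps_XD (euler_fps 1 ^ 9) = (of_nat 9 * (- of_nat 1 * sigma_fps 1)) * euler_fps 1 ^ 9"
    by (intro logderiv_power XD_euler_fps) auto
  thus "fps_XD (euler_fps 1 ^ 9) = (- 9 * sigma_fps 1) * euler_fps 1 ^ 9"
    by simp
qed (simp_all add: cubic_b3_nth euler_fps_nth_0 fps_nth_power_0)

lemma cubic_c3_euler: "cubic_c3 * euler_fps 1 ^ 3 = 27 * (fps_X * euler_fps 3 ^ 9)"
proof (rule logderiv_unique[where k = 1])
  have "fps_XD (cubic_c3 * euler_fps 1 ^ 3) =
     ((1 + 3 * sigma_fps 1 - 27 * sigma_fps 3) + of_nat 3 * (- of_nat 1 * sigma_fps 1)) * (cubic_c3 * euler_fps 1 ^ 3)"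
    by (intro logderiv_mult logderiv_power XD_cubic_c3 XD_euler_fps) auto
  thus "fps_XD (cubic_c3 * euler_fps 1 ^ 3) = (1 - 27 * sigma_fps 3) * (cubic_c3 * euler_fps 1 ^ 3)"
    by simp
  have "fps_XD (fps_X * euler_fps 3 ^ 9) = (1 + of_nat 9 * (- of_nat 3 * sigma_fps 3)) * (fps_X * euler_fps 3 ^ 9)"
    by (intro logderiv_mult logderiv_power XD_fps_X XD_euler_fps) auto
  thus "fps_XD (27 * (fps_X * euler_fps 3 ^ 9)) = (1 - 27 * sigma_fps 3) * (27 * (fps_X * euler_fps 3 ^ 9))"
    by (simp add: fps_XD_mult[of 27])
  show "fps_nth (cubic_c3 * euler_fps 1 ^ 3) 1 = fps_nth (27 * (fps_X * euler_fps 3 ^ 9)) 1"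
    by (simp add: fps_mult_nth_1 cubic_c3_nth fps_nth_power_0 euler_fps_nth_0 del: One_nat_def)
qed simp

text \<open>With $h = b(q)$ and $g = c(q^3)$, written as eta quotients, the claim is $a(q) = h + 3g$. It is proved
together with $a(q^3) = h + g$: the equations for $b^3$ and $c^3$, the latter at $q^3$, express all four
derivatives through $a(q)$, $a(q^3)$, $h$, $g$ and one divisor-sum series, and the two differences \<open>U\<close>, \<open>V\<close>
satisfy a homogeneous linear system.\<close>

lemma cubic_a_euler: "cubic_a * euler_fps 3 = euler_fps 1 ^ 3 + 9 * fps_X * euler_fps 9 ^ 3"
proof -
  define E1 E3 E9 where "E1 = euler_fps 1" "E3 = euler_fps 3" "E9 = euler_fps 9"
  define s1 s3 s9 where "s1 = sigma_fps 1" "s3 = sigma_fps 3" "s9 = sigma_fps 9"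
  define I where "I = inverse E3"
  have I: "E3 * I = 1"
    unfolding I_def by (subst mult.commute, rule inverse_mult_eq_1) (simp add: E1_E3_E9_def euler_fps_nth_0)
  define h where "h = E1 ^ 3 * I"
  define g where "g = 3 * fps_X * E9 ^ 3 * I"
  define a3 where "a3 = cubic_subst cubic_a"
  have h_E3: "h * E3 = E1 ^ 3"
    unfolding h_def using I by Groebner_Basis.algebra
  have g_E3: "g * E3 = 3 * fps_X * E9 ^ 3"
    unfolding g_def using I by Groebner_Basis.algebra
  have beta_h: "cubic_b3 = h ^ 3"
    using cubic_b3_euler I unfolding E1_E3_E9_def[symmetric] h_def by Groebner_Basis.algebra
  have v_g: "cubic_subst cubic_c3 = g ^ 3"
  proof -
    have "cubic_subst cubic_c3 * E3 ^ 3 = 27 * (fps_X ^ 3 * E9 ^ 9)"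
      using arg_cong[OF cubic_c3_euler, of cubic_subst]
      by (simp add: cubic_subst_hom cubic_subst_euler E1_E3_E9_def)
    thus ?thesis
      using I unfolding g_def by Groebner_Basis.algebra
  qed
  have XD_E1: "fps_XD E1 = - s1 * E1" and XD_E3: "fps_XD E3 = - 3 * s3 * E3" and XD_E9: "fps_XD E9 = - 9 * s9 * E9"
    by (simp_all add: E1_E3_E9_def s1_s3_s9_def XD_euler_fps)
  have XD_h: "fps_XD h = (3 * s3 - 3 * s1) * h"
  proof -
    have "fps_XD h * E3 + h * (- 3 * s3 * E3) = (of_nat 3 * (- s1)) * E1 ^ 3"
      using arg_cong[OF h_E3, of fps_XD] logderiv_power[OF XD_E1, of 3] by (simp add: fps_XD_mult XD_E3)
    hence "fps_XD h * E3 + h * (- 3 * s3 * E3) = (- 3 * s1) * E1 ^ 3"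
      by simp
    thus ?thesis using I h_E3 by Groebner_Basis.algebra
  qed
  have XD_g: "fps_XD g = (1 - 27 * s9 + 3 * s3) * g"
  proof -
    have "fps_XD (fps_X * E9 ^ 3) = (1 + of_nat 3 * (- 9 * s9)) * (fps_X * E9 ^ 3)"
      by (intro logderiv_mult logderiv_power XD_fps_X XD_E9)
    hence "fps_XD (3 * (fps_X * E9 ^ 3)) = 3 * ((1 - 27 * s9) * (fps_X * E9 ^ 3))"
      by (simp add: fps_XD_mult[of 3])
    hence "fps_XD g * E3 + g * (- 3 * s3 * E3) = 3 * ((1 - 27 * s9) * (fps_X * E9 ^ 3))"
      using arg_cong[OF g_E3, of fps_XD] by (simp add: fps_XD_mult[of g] XD_E3 mult.assoc)
    thus ?thesis using I g_E3 by Groebner_Basis.algebra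
  qed
  have a3_square: "a3 ^ 2 = 1 + 12 * s3 - 36 * s9"
    using arg_cong[OF cubic_a_square, of cubic_subst]
    by (simp add: cubic_subst_hom cubic_subst_sigma a3_def s1_s3_s9_def)
  have p3: "3 * cubic_subst wp_third = - 1 - 3 * s3 + 27 * s9"
    using arg_cong[OF wp_third_sigma, of cubic_subst]
    by (simp add: cubic_subst_hom cubic_subst_sigma s1_s3_s9_def)
  have XD_a3: "fps_XD a3 = - (a3 ^ 3 - g ^ 3) - 3 * a3 * cubic_subst wp_third"
  proof -
    have "cubic_subst cubic_b3 = a3 ^ 3 - g ^ 3"
      using v_g by (simp add: cubic_c3_def cubic_subst_hom a3_def algebra_simps)
    thus ?thesis
      using arg_cong[OF XD_cubic_a, of cubic_subst]
      by (simp add: cubic_subst_hom a3_def XD_cubic_subst)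
  qed
  define U V where "U = cubic_a - (h + 3 * g)" and "V = a3 - (h + g)"
  define k where "k = 1 - 24 * s3"
  \<comment> \<open>the coefficients of the system: polynomial difference quotients between \<open>cubic_a\<close>, \<open>a3\<close> and the values \<open>h + 3 * g\<close>, \<open>h + g\<close> claimed for them\<close>
  define A where "A = 3 * k + (cubic_a ^ 2 + cubic_a * (h + 3 * g) + (h + 3 * g) ^ 2) + 3 * h * (cubic_a + h + 3 * g)"
  define B where "B = - 27 * g * (a3 + h + g)"
  define C where "C = h * (cubic_a + h + 3 * g)"
  define D where "D = k - (a3 ^ 2 + a3 * (h + g) + (h + g) ^ 2) - 3 * g * (a3 + h + g)"
  have "12 * fps_XD U = 4 * (3 * fps_XD cubic_a) - 12 * fps_XD h - 36 * fps_XD g"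
    by (simp add: U_def fps_XD_diff fps_XD_mult algebra_simps)
  hence sysU: "12 * fps_XD U = A * U + B * V"
    unfolding XD_cubic_a XD_h XD_g U_def V_def A_def B_def k_def beta_h
    using cubic_a_square[folded s1_s3_s9_def] a3_square wp_third_sigma[folded s1_s3_s9_def]
    by Groebner_Basis.algebra
  have "4 * fps_XD V = 4 * fps_XD a3 - 4 * fps_XD h - 4 * fps_XD g"
    by (simp add: V_def fps_XD_diff algebra_simps)
  hence sysV: "4 * fps_XD V = C * U + D * V"
    unfolding XD_a3 XD_h XD_g U_def V_def C_def D_def k_def
    using cubic_a_square[folded s1_s3_s9_def] a3_square p3
    by Groebner_Basis.algebra
  have E_0: "fps_nth E1 0 = 1" "fps_nth E3 0 = 1" "fps_nth E9 0 = 1" "fps_nth I 0 = 1"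
    by (simp_all add: E1_E3_E9_def I_def euler_fps_nth_0)
  have h_0: "fps_nth h 0 = 1" and g_0: "fps_nth g 0 = 0" and g_1: "fps_nth g 1 = 3"
    by (simp_all add: h_def g_def fps_nth_power_0 E_0 fps_mult_nth_1 del: One_nat_def)
  have s_0: "fps_nth s1 0 = 0" "fps_nth s3 0 = 0" "fps_nth s1 1 = 1" "fps_nth s3 1 = 0"
    by (simp_all add: s1_s3_s9_def sigma_fps_def)
  have h_1: "fps_nth h 1 = - 3"
  proof -
    have "fps_nth (fps_XD h) 1 = fps_nth ((3 * s3 - 3 * s1) * h) 1"
      by (simp only: XD_h)
    thus ?thesis by (simp add: fps_mult_nth_1 s_0 h_0 del: One_nat_def)
  qed
  have a3_0: "fps_nth a3 0 = 1"
    by (simp add: a3_def cubic_subst_nth cubic_a_nth)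
  have "U = 0"
  proof (rule linear_system_unique[OF sysU sysV])
    show "fps_nth A 0 = 12" "fps_nth B 0 = 0" "fps_nth D 0 = - 2" "fps_nth U 1 = 0"
      by (simp_all add: A_def B_def D_def U_def k_def fps_nth_power_0 h_0 h_1 g_0 g_1 s_0 a3_0 cubic_a_nth del: One_nat_def)
  qed
  hence "cubic_a = h + 3 * g" by (simp add: U_def)
  hence "cubic_a * E3 = E1 ^ 3 + 9 * fps_X * E9 ^ 3"
    using h_E3 g_E3 by Groebner_Basis.algebra
  thus ?thesis by (simp add: E1_E3_E9_def)
qed

text \<open>In terms of $a$, $b^3$ and $c^3$ the sixth derivative is $\frac13 a^2 b^3 (9c^3 + 41 b^3)$, and
$a^2 b^3 c^3$ is 27 times the cusp form.\<close>

lemma level3_identity: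
  "\<exists>G. int_fps G \<and> 3 * at0 (wp omega 6) = 243 * delta3_fps + 41 * G"
proof (intro exI conjI)
  have "fps_nth cubic_a n \<in> \<int>" "fps_nth cubic_b3 n \<in> \<int>" for n
    by (cases "n = 0"; auto simp: cubic_a_def cubic_b3_def intro!: Ints_sum Ints_mult Ints_minus)+
  hence "int_fps cubic_a" "int_fps cubic_b3"
    by (auto simp: int_fps_def)
  thus "int_fps ((cubic_a * cubic_b3) * (cubic_a * cubic_b3))"
    by (intro int_fps_mult)
  have delta: "27 * delta3_fps = cubic_a ^ 2 * (cubic_b3 * cubic_c3)"
    unfolding cubic_b3_c3 delta3_fps_def using cubic_a_euler by Groebner_Basis.algebra
  \<comment> \<open>scaled so that only \<open>6 * zeta_third\<close> and \<open>9 * wp1_third\<close> occur, which are multiples of \<open>cubic_a\<close> and \<open>cubic_b3\<close>\<close>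
  have "108 * (3 * at0 (wp omega 6)) = (6 * zeta_third) ^ 2 * (9 * wp1_third) * (36 * (6 * zeta_third) ^ 3 + 384 * (9 * wp1_third))"
    unfolding wp6_third by Groebner_Basis.algebra
  also have "\<dots> = 108 * (cubic_a ^ 2 * (9 * (cubic_b3 * cubic_c3) + 41 * cubic_b3 ^ 2))"
    unfolding zeta_third_cubic_a wp1_third_cubic_b3 cubic_c3_def using sqrt_m3_fps_square by Groebner_Basis.algebra
  finally have "3 * at0 (wp omega 6) = cubic_a ^ 2 * (9 * (cubic_b3 * cubic_c3) + 41 * cubic_b3 ^ 2)"
    by (subst (asm) mult_cancel_left) simp
  thus "3 * at0 (wp omega 6) = 243 * delta3_fps + 41 * ((cubic_a * cubic_b3) * (cubic_a * cubic_b3))"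
    using delta by Groebner_Basis.algebra
qed

text \<open>Here $3 \nmid d$ for all divisors, so $\omega^d + \omega^{-d} = -1$ and $-3\,\sigma_7(n) = 243\,\tau(n)$ modulo 41,
where $243 = -3 + 6 \cdot 41$. The constant 14 in the proof is the inverse of 3 modulo 41.\<close>

lemma tau_8_3_cong:
  assumes "\<not> 3 dvd n"
  shows "[tau_8_3 n = int (divisor_sum 7 n)] (mod 41)"
proof -
  have n: "n > 0" using assms by (auto intro!: Nat.gr0I)
  obtain G where G: "int_fps G" "3 * at0 (wp omega 6) = 243 * delta3_fps + 41 * G"
    using level3_identity by blast
  obtain g where g: "fps_nth G n = of_int g"
    using G(1) by (auto simp: int_fps_def elim!: Ints_cases)
  have "fps_nth (at0 (wp omega 6)) n = (\<Sum>d | d dvd n. - (of_nat d ^ 7))"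
    unfolding at0_wp_nth[OF n]
  proof (rule sum.cong, goal_cases)
    case (2 d)
    hence "\<not> 3 dvd d" using assms by (auto intro: dvd_trans)
    thus ?case using omega_power(1)[of d] by simp
  qed simp
  also have "\<dots> = of_int (- int (divisor_sum 7 n))"
    by (simp add: divisor_sum_def sum_negf)
  finally have "of_int (3 * (- int (divisor_sum 7 n))) = (of_int (243 * tau_8_3 n + 41 * g) :: complex)"
    using arg_cong[OF G(2), of "\<lambda>F. fps_nth F n"] g by (simp add: delta3_fps_nth del: at0_nth)
  hence "3 * (- int (divisor_sum 7 n)) = 243 * tau_8_3 n + 41 * g"
    by (simp only: of_int_eq_iff)
  hence "tau_8_3 n - int (divisor_sum 7 n) =
         41 * (14 * (6 * tau_8_3 n + g) - (tau_8_3 n - int (divisor_sum 7 n)))"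
    by (simp add: algebra_simps)
  thus ?thesis
    unfolding cong_iff_dvd_diff by (rule dvdI)
qed

section \<open>Prime powers\<close>

theorem corollary4p8:
  fixes l :: nat
  assumes "l \<ge> 1"
  shows "(\<forall>p::nat. prime p \<and> odd p \<longrightarrow>
            [tau_8_2 (p ^ l) = int (divisor_sum 7 (p ^ l))] (mod 17))
       \<and> (\<forall>p::nat. prime p \<and> p \<ge> 5 \<longrightarrow>
            [tau_8_3 (p ^ l) = int (divisor_sum 7 (p ^ l))] (mod 41))
       \<and> [tau_8_2 (17 ^ l) = 1] (mod 17)
       \<and> [tau_8_3 (41 ^ l) = 1] (mod 41)"
proof -
  have level2: "[tau_8_2 (p ^ l) = int (divisor_sum 7 (p ^ l))] (mod 17)" if "odd p" for p
    by (rule tau_8_2_cong) (use that in simp)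
  have level3: "[tau_8_3 (p ^ l) = int (divisor_sum 7 (p ^ l))] (mod 41)" if "prime p" "p \<ge> 5" for p
  proof (rule tau_8_3_cong)
    have "\<not> 3 dvd p"
      using that primes_dvd_imp_eq[of 3 p] by auto
    thus "\<not> 3 dvd p ^ l"
      using prime_dvd_power[of 3 p l] by auto
  qed
  have sigma: "[int (divisor_sum 7 (p ^ l)) = 1] (mod (int p))" if "prime p" for p
  proof -
    have "p > 0" using that by (rule prime_gt_0_nat)
    have "divisor_sum 7 (p ^ l) = 1 + (\<Sum>e \<in> {e. e dvd p ^ l} - {1}. e ^ 7)"
      unfolding divisor_sum_def using \<open>p > 0\<close> by (subst sum.remove[of _ 1]) auto
    moreover have "p dvd (\<Sum>e \<in> {e. e dvd p ^ l} - {1}. e ^ 7)"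
    proof (rule dvd_sum)
      fix e assume "e \<in> {e. e dvd p ^ l} - {1}"
      then obtain i where "e = p ^ i" "e \<noteq> 1"
        using divides_primepow_nat[OF \<open>prime p\<close>] by auto
      hence "p dvd e" by (cases i) auto
      thus "p dvd e ^ 7" by (rule dvd_trans) simp
    qed
    ultimately obtain c where "divisor_sum 7 (p ^ l) = 1 + p * c"
      by (auto elim: dvdE)
    thus ?thesis
      by (simp add: cong_iff_dvd_diff)
  qed
  have p17: "prime (17 :: nat)" and p41: "prime (41 :: nat)"
    by simp_all
  have "[tau_8_2 (17 ^ l) = 1] (mod 17)"
    using cong_trans[OF level2[of 17]] sigma[OF p17] by simp
  moreover have "[tau_8_3 (41 ^ l) = 1] (mod 41)"
    using cong_trans[OF level3[OF p41]] sigma[OF p41] by simp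
  ultimately show ?thesis
    using level2 level3 by blast
qed

end
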